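(* Let $\Omega\subset\mathbf{R}^n$ be a uniform domain, with associated constant $K$ (the constant in the inequality $d_1\le K d_2$ on a dyadic Whitney decomposition of $\Omega$). For each $\varepsilon>0$ there is a constant $C=C(K,\varepsilon)$ such that for each $f\in bmo^\infty_\infty(\Omega)$ there is an extension $\overline f\in bmo^\infty_\infty(\Omega_{2\varepsilon})$ of $f$ such that $$\|\overline f\|_{bmo^\infty_\infty(\Omega_{2\varepsilon})}\le C\,\|f\|_{bmo^\infty_\infty(\Omega)}$$ and $\operatorname{supp}\overline f\subset\overline{\Omega_\varepsilon}$, where $\Omega_\varepsilon=\{x\in\mathbf{R}^n : d(x,\overline\Omega)<\varepsilon\}$. The operator $f\mapsto\overline f$ is a bounded linear operator.
   Context: For a domain $D\subset\mathbf{R}^n$, with $B_r(x)$ the closed ball, $f_B=\frac1{|B|}\int_Bf\,dy$ and a fixed $r_0>0$, $bmo^\infty_\infty(D)$ is the space of $f\in L^1_{\mathrm{loc}}(D)$ with finite norm $$\|f\|_{bmo^\infty_\infty(D)}=\sup_{B_r(x)\subset D}\frac1{|B_r(x)|}\int_{B_r(x)}|f-f_{B_r(x)}|\,dy+\sup_{x\in\mathbf{R}^n}\int_{B_{r_0}(x)\cap D}|f|\,dy .$$ (Different choices of $r_0$ give equivalent norms.) $d(B,C)=\inf\{|x-y|:x\in B,y\in C\}$. Dyadic Whitney decomposition of a set $A$: a family $\mathcal A=\{Q_j\}_{j\in\mathbf{N}}$ of dyadic closed cubes in $A$, of side length $\ell(Q_j)$, with (i) $A=\bigcup_jQ_j$;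 (ii) $\operatorname{int}Q_j\cap\operatorname{int}Q_k=\emptyset$ if $j\ne k$; (iii) $\sqrt n\le d(Q_j,\mathbf{R}^n\setminus A)/\ell(Q_j)\le4\sqrt n$ for all $j$; (iv) $1/4\le\ell(Q_k)/\ell(Q_j)\le4$ if $Q_j\cap Q_k\ne\emptyset$. $d_1(Q_j,Q_k)$ is the length $m$ of a shortest chain $Q(0)=Q_j,\dots,Q(m)=Q_k$ in $\mathcal A$ with $Q(\ell)\cap Q(\ell+1)\ne\emptyset$ for $0\le\ell\le m-1$, and $$d_2(Q_j,Q_k)=\Big|\log\frac{\ell(Q_j)}{\ell(Q_k)}\Big|+\log\Big(\frac{d(Q_j,Q_k)}{\ell(Q_j)+\ell(Q_k)}+2\Big).$$ A domain $\Omega$ is a uniform domain if there exist $a,b>0$ such that for all $x,y\in\Omega$ there is a rectifiable curve $\gamma\subset\Omega$ joining $x$ and $y$ of length $s(\gamma)\le a|x-y|$ with $\min\{s(\gamma(x,z)),s(\gamma(y,z))\}\le b\,d(z,\partial\Omega)$ for all $z\in\gamma$, where $\gamma(x,z)$ is the part of $\gamma$ between $x$ and $z$. Equivalently, there is $K>0$ such that $d_1(Q_j,Q_k)\le K\,d_2(Q_j,Q_k)$ for all $Q_j,Q_k\in\mathcal A$, for some dyadic Whitney decomposition $\mathcal A$ of $\Omega$.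
   Formalization: The constant C depends, besides K and ε (and the fixed n, r_0), on the radius ρ>0 of some closed ball contained in Ω, and is uniform over all such Ω; with C=C(K,ε) alone the claim fails for f=1 on balls whose radius tends to 0. *)

theory Defs
  imports "HOL-Analysis.Analysis"
begin

definition domain_set :: "'a::euclidean_space set \<Rightarrow> bool" where
  "domain_set D \<longleftrightarrow> open D \<and> connected D \<and> D \<noteq> {}"


section \<open>The space of functions of bounded mean oscillation\<close>

text \<open>
  Elements of \<open>L\<^sup>1\<^sub>l\<^sub>o\<^sub>c(D)\<close> are represented by total functions whose values
  outside \<open>D\<close> are irrelevant; equality of elements is equality almost everywhere on \<open>D\<close>.
\<close>

definition locally_integrable :: "'a::euclidean_space set \<Rightarrow> ('a \<Rightarrow> real) \<Rightarrow> bool" where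
  "locally_integrable D f \<longleftrightarrow> (\<forall>S. compact S \<and> S \<subseteq> D \<longrightarrow> set_integrable lebesgue S f)"

definition ae_eq_on :: "'a::euclidean_space set \<Rightarrow> ('a \<Rightarrow> real) \<Rightarrow> ('a \<Rightarrow> real) \<Rightarrow> bool" where
  "ae_eq_on D f g \<longleftrightarrow> (AE x in lebesgue. x \<in> D \<longrightarrow> f x = g x)"

definition average :: "'a::euclidean_space set \<Rightarrow> ('a \<Rightarrow> real) \<Rightarrow> real" where
  "average B f = (LINT y:B|lebesgue. f y) / measure lebesgue B"

definition bmo_norm :: "real \<Rightarrow> 'a::euclidean_space set \<Rightarrow> ('a \<Rightarrow> real) \<Rightarrow> ennreal" where
  "bmo_norm r0 D f =
     (SUP (x, r) \<in> {(x, r). 0 < r \<and> cball x r \<subseteq> D}.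
        (\<integral>\<^sup>+ y \<in> cball x r. ennreal \<bar>f y - average (cball x r) f\<bar> \<partial>lebesgue)
          / emeasure lebesgue (cball x r))
   + (SUP x. \<integral>\<^sup>+ y \<in> cball x r0 \<inter> D. ennreal \<bar>f y\<bar> \<partial>lebesgue)"

definition bmo :: "real \<Rightarrow> 'a::euclidean_space set \<Rightarrow> ('a \<Rightarrow> real) set" where
  "bmo r0 D = {f. locally_integrable D f \<and> bmo_norm r0 D f < \<infinity>}"

text \<open>
  The support, as an element of \<open>L\<^sup>1\<^sub>l\<^sub>o\<^sub>c(D)\<close>: the complement in \<open>D\<close> of the largest
  open set on which the function vanishes almost everywhere.
\<close>

definition ess_support :: "'a::euclidean_space set \<Rightarrow> ('a \<Rightarrow> real) \<Rightarrow> 'a set" where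
  "ess_support D f = {x \<in> D. \<forall>U. open U \<and> x \<in> U \<longrightarrow> \<not> ae_eq_on (U \<inter> D) f (\<lambda>_. 0)}"


section \<open>Dyadic Whitney decompositions\<close>

text \<open>
  The pair \<open>(k, m)\<close> encodes the closed cube with side length \<open>2\<close> to the power \<open>k\<close> and lower
  corner \<open>m\<close> times that side length; the encoding is injective.
\<close>

type_synonym 'n dyadic = "int \<times> (int, 'n) vec"

definition side :: "'n dyadic \<Rightarrow> real" where
  "side q = 2 powi fst q"

definition cube :: "'n::finite dyadic \<Rightarrow> (real ^ 'n) set" where
  "cube q = cbox (\<chi> i. of_int (snd q $ i) * side q) (\<chi> i. (of_int (snd q $ i) + 1) * side q)"

text \<open>
  The distance to an empty complement is infinite in the usual convention but
  \<open>setdist _ {} = 0\<close>; under either one the two bounds on the distance cannot both hold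
  when \<open>A = UNIV\<close>, so the whole space has no Whitney decomposition.
\<close>

definition whitney_decomposition :: "(real ^ 'n::finite) set \<Rightarrow> (nat \<Rightarrow> 'n dyadic) \<Rightarrow> bool" where
  "whitney_decomposition A Q \<longleftrightarrow>
     A = (\<Union>j. cube (Q j)) \<and>
     (\<forall>j k. j \<noteq> k \<longrightarrow> interior (cube (Q j)) \<inter> interior (cube (Q k)) = {}) \<and>
     (\<forall>j. sqrt (real CARD('n)) \<le> setdist (cube (Q j)) (- A) / side (Q j) \<and>
          setdist (cube (Q j)) (- A) / side (Q j) \<le> 4 * sqrt (real CARD('n))) \<and>
     (\<forall>j k. cube (Q j) \<inter> cube (Q k) \<noteq> {} \<longrightarrow>
          1 / 4 \<le> side (Q k) / side (Q j) \<and> side (Q k) / side (Q j) \<le> 4)"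

definition is_chain :: "(nat \<Rightarrow> 'n::finite dyadic) \<Rightarrow> nat \<Rightarrow> nat \<Rightarrow> nat \<Rightarrow> bool" where
  "is_chain Q j k m \<longleftrightarrow>
     (\<exists>c :: nat \<Rightarrow> nat. c 0 = j \<and> c m = k \<and>
        (\<forall>l<m. cube (Q (c l)) \<inter> cube (Q (c (Suc l))) \<noteq> {}))"

text \<open>With values in \<^typ>\<open>ereal\<close> the infimum is \<open>\<infinity>\<close> if there is no chain.\<close>

definition chain_dist :: "(nat \<Rightarrow> 'n::finite dyadic) \<Rightarrow> nat \<Rightarrow> nat \<Rightarrow> ereal" where
  "chain_dist Q j k = (INF m \<in> {m. is_chain Q j k m}. ereal (real m))"

definition log_dist :: "(nat \<Rightarrow> 'n::finite dyadic) \<Rightarrow> nat \<Rightarrow> nat \<Rightarrow> real" where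
  "log_dist Q j k =
     \<bar>ln (side (Q j) / side (Q k))\<bar>
     + ln (setdist (cube (Q j)) (cube (Q k)) / (side (Q j) + side (Q k)) + 2)"


section \<open>Uniform domains\<close>

definition curve_length :: "(real \<Rightarrow> 'a::metric_space) \<Rightarrow> real \<Rightarrow> real \<Rightarrow> ennreal" where
  "curve_length g s t =
     (SUP p \<in> {p. sorted p \<and> set p \<subseteq> {s..t}}.
        ennreal (\<Sum>i<length p - 1. dist (g (p ! i)) (g (p ! Suc i))))"

text \<open>
  The alternative \<open>frontier D = {}\<close> expresses that the distance to the empty set is infinite,
  whereas \<open>infdist z {} = 0\<close>.
\<close>

definition uniform_domain :: "'a::euclidean_space set \<Rightarrow> bool" where
  "uniform_domain D \<longleftrightarrow> domain_set D \<and>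
     (\<exists>a>0. \<exists>b>0. \<forall>x\<in>D. \<forall>y\<in>D. \<exists>g.
        path g \<and> path_image g \<subseteq> D \<and> pathstart g = x \<and> pathfinish g = y \<and>
        curve_length g 0 1 \<le> ennreal (a * dist x y) \<and>
        (\<forall>t\<in>{0..1}. frontier D = {} \<or>
           min (curve_length g 0 t) (curve_length g t 1)
             \<le> ennreal (b * infdist (g t) (frontier D))))"

definition has_uniformity_constant :: "(real ^ 'n::finite) set \<Rightarrow> real \<Rightarrow> bool" where
  "has_uniformity_constant D K \<longleftrightarrow>
     (\<exists>Q. whitney_decomposition D Q \<and>
        (\<forall>j k. chain_dist Q j k \<le> ereal (K * log_dist Q j k)))"

definition neighbourhood :: "'a::euclidean_space set \<Rightarrow> real \<Rightarrow> 'a set" where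
  "neighbourhood D e = {x. infdist x (closure D) < e}"


section \<open>Extension operators\<close>

definition linear_extension_operator ::
  "real \<Rightarrow> 'a::euclidean_space set \<Rightarrow> 'a set \<Rightarrow> (('a \<Rightarrow> real) \<Rightarrow> 'a \<Rightarrow> real) \<Rightarrow> bool" where
  "linear_extension_operator r0 D D' E \<longleftrightarrow>
     (\<forall>f\<in>bmo r0 D. E f \<in> bmo r0 D' \<and> ae_eq_on D (E f) f) \<and>
     (\<forall>f\<in>bmo r0 D. \<forall>g\<in>bmo r0 D. ae_eq_on D f g \<longrightarrow> ae_eq_on D' (E f) (E g)) \<and>
     (\<forall>f\<in>bmo r0 D. \<forall>g\<in>bmo r0 D. \<forall>a b.
        ae_eq_on D' (E (\<lambda>x. a * f x + b * g x)) (\<lambda>x. a * E f x + b * E g x))"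

end

theory Submission
  imports Defs
begin

text \<open>
  Along a shortest chain of Whitney cubes only boundedly many consecutive cubes have comparable
  size, because \<open>d\<^sub>1 \<le> K d\<^sub>2\<close> holds on every subchain (the argument of Gehring and
  Osgood). Hence every cube sees, up to a fixed scale, cubes of each larger size at a comparable
  distance. The extension is Jones's: near \<open>\<Omega>\<close>, the value at a point outside is the average of
  \<open>f\<close> over a cube whose size and distance are comparable to the distance from the point to \<open>\<Omega>\<close>;
  far from \<open>\<Omega>\<close> it is zero, which does no harm since averages over cubes of a fixed size are bounded.

  The averages over two cubes differ by at most a multiple of their chain distance, so on a ball
  of radius \<open>r\<close> meeting the complement the oscillation is governed by the integral of
  \<open>log (r / d(x, \<partial>\<Omega>))\<close>. This logarithm is dominated by the number of Whitney cubes near the ball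
  having \<open>x\<close> in a fixed dilation, one for each scale between \<open>d(x, \<partial>\<Omega>)\<close> and \<open>r\<close>; as the cubes are
  disjoint, the integral of that number is at most a multiple of the volume of the ball. The number
  is infinite on the boundary, so the same estimate shows that the boundary is negligible.
\<close>

section \<open>Whitney cubes and chains\<close>

lemma norm_vec_le_sqrt_card:
  fixes x :: "real ^ 'n::finite"
  assumes "\<And>i. \<bar>x $ i\<bar> \<le> a"
  shows "norm x \<le> sqrt (real CARD('n)) * a"
proof -
  have "a \<ge> 0" using assms[of undefined] by linarith
  have "(\<Sum>i\<in>UNIV. (x $ i)\<^sup>2) \<le> (\<Sum>i\<in>(UNIV::'n set). a\<^sup>2)"
    using assms by (intro sum_mono) (metis abs_ge_zero power2_abs power_mono)
  then have "norm x \<le> sqrt (real CARD('n) * a\<^sup>2)"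
    by (simp add: norm_vec_def L2_set_def)
  then show ?thesis
    using \<open>a \<ge> 0\<close> by (simp add: real_sqrt_mult)
qed

lemma side_pos [simp]: "0 < side q"
  by (simp add: side_def)

definition centre :: "'n::finite dyadic \<Rightarrow> real ^ 'n" where
  "centre q = (\<chi> i. (of_int (snd q $ i) + 1 / 2) * side q)"

lemma dist_cube_le:
  fixes q :: "'n::finite dyadic"
  assumes "x \<in> cube q" "y \<in> cube q"
  shows "dist x y \<le> sqrt (real CARD('n)) * side q"
proof -
  have "\<bar>(x - y) $ i\<bar> \<le> side q" for i
  proof -
    have "of_int (snd q $ i) * side q \<le> x $ i \<and> x $ i \<le> (of_int (snd q $ i) + 1) * side q"
      "of_int (snd q $ i) * side q \<le> y $ i \<and> y $ i \<le> (of_int (snd q $ i) + 1) * side q"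
      using assms by (auto simp: cube_def mem_box_cart)
    then show ?thesis
      by (simp only: vector_minus_component abs_le_iff distrib_right) linarith
  qed
  then show ?thesis
    unfolding dist_norm by (rule norm_vec_le_sqrt_card)
qed

lemma dist_centre_le:
  fixes q :: "'n::finite dyadic"
  assumes "x \<in> cube q"
  shows "dist x (centre q) \<le> sqrt (real CARD('n)) / 2 * side q"
proof -
  have "\<bar>(x - centre q) $ i\<bar> \<le> side q / 2" for i
  proof -
    have "of_int (snd q $ i) * side q \<le> x $ i \<and> x $ i \<le> (of_int (snd q $ i) + 1) * side q"
      using assms by (auto simp: cube_def mem_box_cart)
    then show ?thesis
      by (simp only: centre_def vector_minus_component vec_lambda_beta abs_le_iff distrib_right) linarith
  qed
  from norm_vec_le_sqrt_card[OF this] show ?thesis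
    by (simp add: dist_norm)
qed

lemma cball_centre_subset: "cball (centre q) (side q / 4) \<subseteq> interior (cube q)"
proof
  fix x assume "x \<in> cball (centre q) (side q / 4)"
  then have "norm (x - centre q) \<le> side q / 4"
    by (simp add: dist_norm norm_minus_commute)
  then have *: "\<bar>(x - centre q) $ i\<bar> \<le> side q / 4" for i
    by (metis Finite_Cartesian_Product.norm_nth_le order.trans real_norm_def)
  have "of_int (snd q $ i) * side q < x $ i \<and> x $ i < (of_int (snd q $ i) + 1) * side q" for i
    using *[of i] side_pos[of q]
    by (simp only: centre_def vector_minus_component vec_lambda_beta abs_le_iff distrib_right) linarith
  then show "x \<in> interior (cube q)"
    by (simp add: cube_def interior_cbox mem_box_cart)
qed

lemma centre_in_cube: "centre q \<in> cube q"
proof -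
  have "centre q \<in> cball (centre q) (side q / 4)"
    by (simp add: less_imp_le)
  then show ?thesis
    using cball_centre_subset interior_subset by blast
qed

lemma one_le_sqrt_card: "1 \<le> sqrt (real CARD('n::finite))"
  by (simp add: Suc_leI)

locale whitney =
  fixes \<Omega> :: "(real ^ 'n::finite) set" and Q :: "nat \<Rightarrow> 'n dyadic" and s :: real
  defines s_def: "s \<equiv> sqrt (real CARD('n))"
  assumes decomposition: "whitney_decomposition \<Omega> Q"
begin

abbreviation l :: "nat \<Rightarrow> real" where "l j \<equiv> side (Q j)"
abbreviation q :: "nat \<Rightarrow> (real ^ 'n) set" where "q j \<equiv> cube (Q j)"
abbreviation c :: "nat \<Rightarrow> real ^ 'n" where "c j \<equiv> centre (Q j)"
text \<open>Closed Whitney cubes share faces, whereas these balls lie in the interiors and are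
  disjoint, with volume comparable to that of the cubes. Being balls inside \<Omega>, they also suit
  the norm, which only sees balls.\<close>

abbreviation core :: "nat \<Rightarrow> (real ^ 'n) set" where "core j \<equiv> cball (c j) (l j / 4)"

lemma s_ge: "1 \<le> s" unfolding s_def by (rule one_le_sqrt_card)

lemma Union_q: "\<Omega> = (\<Union>j. q j)"
  using decomposition unfolding whitney_decomposition_def by blast

lemma setdist_bounds: "s \<le> setdist (q j) (- \<Omega>) / l j" "setdist (q j) (- \<Omega>) / l j \<le> 4 * s"
  using decomposition unfolding whitney_decomposition_def s_def by blast+

lemma disjoint_core: "i \<noteq> j \<Longrightarrow> core i \<inter> core j = {}"
  using decomposition cball_centre_subset unfolding whitney_decomposition_def by blast

lemma core_subset: "core j \<subseteq> q j" "core j \<subseteq> \<Omega>"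
  using cball_centre_subset[of "Q j"] interior_subset[of "q j"] Union_q by blast+

lemma side_adjacent: "q i \<inter> q j \<noteq> {} \<Longrightarrow> l j \<le> 4 * l i"
proof -
  assume "q i \<inter> q j \<noteq> {}"
  then have "l j / l i \<le> 4"
    using decomposition unfolding whitney_decomposition_def by blast
  then show ?thesis by (simp add: pos_divide_le_eq)
qed

lemma side_le_dist:
  assumes "x \<in> q j" "y \<notin> \<Omega>"
  shows "s * l j \<le> dist x y"
proof -
  have "s * l j \<le> setdist (q j) (- \<Omega>)"
    using setdist_bounds(1)[of j] by (simp add: pos_le_divide_eq)
  also have "\<dots> \<le> dist x y"
    using assms by (intro setdist_le_dist) auto
  finally show ?thesis .
qed

lemma compl_ne: "- \<Omega> \<noteq> {}"
proof
  assume "- \<Omega> = {}"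
  \<comment> \<open>The default value \<open>setdist _ {} = 0\<close> contradicts the lower Whitney
    bound.\<close>
  then have "s \<le> 0" using setdist_bounds(1)[of 0] by (simp only:) simp
  then show False using s_ge by linarith
qed

text \<open>The upper Whitney bound \<open>4 * s\<close> plus the diameter \<open>s * l j\<close> of
  the cube gives the factor 5. A ball contained in \<Omega> thus certifies a cube of comparable
  size.\<close>

lemma side_ge_of_cball_subset:
  assumes "x \<in> q j" "cball x r \<subseteq> \<Omega>"
  shows "r \<le> 5 * s * l j"
proof -
  have "r - s * l j \<le> setdist (q j) (- \<Omega>)"
  proof (rule le_setdistI)
    show "q j \<noteq> {}" "- \<Omega> \<noteq> {}" using compl_ne assms by auto
    fix a b assume ab: "a \<in> q j" "b \<in> - \<Omega>"
    have "r \<le> dist x b" using assms ab by (meson ComplD linorder_le_cases mem_cball subsetD)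
    also have "\<dots> \<le> dist x a + dist a b" by (rule dist_triangle)
    also have "dist x a \<le> s * l j" using assms ab unfolding s_def by (intro dist_cube_le)
    finally show "r - s * l j \<le> dist a b" by simp
  qed
  also have "\<dots> \<le> 4 * s * l j"
    using setdist_bounds(2)[of j] by (simp add: pos_divide_le_eq)
  finally show ?thesis by simp
qed

lemma cball_subset:
  assumes "x \<in> q j" "r < s * l j"
  shows "cball x r \<subseteq> \<Omega>"
  using side_le_dist[OF assms(1)] assms(2) by fastforce

lemma dist_c_le: "x \<in> q j \<Longrightarrow> dist x (c j) \<le> s / 2 * l j"
  unfolding s_def by (rule dist_centre_le)

text \<open>A relation, so that chains of length \<open>m\<close> are its \<open>m\<close>-th
  powers, and splitting and joining chains become laws of \<open>^^\<close>.\<close>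

definition adjacency :: "(nat \<times> nat) set" where
  "adjacency = {(i, j). q i \<inter> q j \<noteq> {}}"

lemma is_chain_iff: "is_chain Q j k m \<longleftrightarrow> (j, k) \<in> adjacency ^^ m"
  unfolding is_chain_def relpow_fun_conv adjacency_def by auto

text \<open>An infimum over natural numbers is attained once the set is nonempty, and a real bound
  excludes the value \<infinity> of the empty infimum.\<close>

lemma chain_dist_leD:
  assumes "chain_dist Q j k \<le> ereal b"
  obtains m where "(j, k) \<in> adjacency ^^ m" "real m \<le> b"
proof -
  let ?S = "{m. is_chain Q j k m}"
  have "?S \<noteq> {}"
  proof
    assume "?S = {}"
    then have "chain_dist Q j k = \<infinity>"
      unfolding chain_dist_def by (simp only: image_empty Inf_empty top_ereal_def)
    then show False using assms by simp
  qed
  then have m: "(LEAST m. m \<in> ?S) \<in> ?S" by (meson LeastI ex_in_conv)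
  have "ereal (real (LEAST m. m \<in> ?S)) \<le> chain_dist Q j k"
    unfolding chain_dist_def by (intro INF_greatest) (simp add: Least_le)
  then have "ereal (real (LEAST m. m \<in> ?S)) \<le> ereal b" using assms by (rule order_trans)
  then show thesis using that m is_chain_iff by auto
qed

text \<open>A chain with \<open>b - a\<close> steps has \<open>b - a + 1\<close> cubes, each of
  diameter at most \<open>s * T\<close>.\<close>

lemma dist_relpow_le:
  assumes "\<And>i. a \<le> i \<Longrightarrow> i \<le> b \<Longrightarrow> l (g i) \<le> T" "a \<le> b"
    "\<And>i. a \<le> i \<Longrightarrow> i < b \<Longrightarrow> (g i, g (Suc i)) \<in> adjacency" "x \<in> q (g a)" "y \<in> q (g b)"
  shows "dist x y \<le> (real (b - a) + 1) * s * T"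
  using \<open>a \<le> b\<close> assms(1,3,5)
proof (induction b arbitrary: y rule: dec_induct)
  case base
  have "dist x y \<le> s * l (g a)" using base assms(4) unfolding s_def by (intro dist_cube_le)
  also have "\<dots> \<le> s * T" using base s_ge by (intro mult_left_mono) auto
  finally show ?case by simp
next
  case (step b)
  obtain z where z: "z \<in> q (g b)" "z \<in> q (g (Suc b))"
    using step.prems(2)[of b] step.hyps unfolding adjacency_def by auto
  have "dist x z \<le> (real (b - a) + 1) * s * T"
    by (rule step.IH) (use step.prems z in auto)
  moreover have "dist z y \<le> s * T"
  proof -
    have "dist z y \<le> s * l (g (Suc b))" using z step.prems unfolding s_def by (intro dist_cube_le)
    also have "\<dots> \<le> s * T" using step s_ge by (intro mult_left_mono) auto
    finally show ?thesis .
  qed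
  moreover have "real (Suc b - a) = real (b - a) + 1" using step.hyps by linarith
  ultimately show ?case using dist_triangle[of x y z] by (simp add: algebra_simps)
qed

end

section \<open>Cubes at every scale\<close>

lemma linear_le_log_bound:
  fixes K s x :: real
  assumes "0 < K" "0 < s" and x: "0 \<le> x" "x \<le> K * (ln 8 + ln (2 + 4 * s * (x + 1)))"
  shows "x \<le> 2 * (K * ln 8 + K * ln (8 * s * K) + (2 + 4 * s) / (8 * s))"
proof -
  \<comment> \<open>The logarithm is linearised at \<open>a\<close> with slope \<open>1 / a\<close>;
    for this \<open>a\<close> the term \<open>4 * s * x\<close> under the logarithm contributes
    exactly \<open>x / 2\<close>, which the left side absorbs.\<close>
  define a where "a = 8 * s * K"
  have a: "a > 0" using assms by (simp add: a_def)
  define y where "y = 2 + 4 * s * (x + 1)"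
  have y: "y > 0" using x assms by (simp add: y_def add_pos_nonneg)
  have "ln y - ln a \<le> y / a"
    using ln_le_minus_one[of "y / a"] a y by (simp add: ln_div)
  then have "K * ln y \<le> K * (ln a + y / a)"
    using assms by (intro mult_left_mono) auto
  also have "K * (y / a) = (2 + 4 * s) / (8 * s) + x / 2"
    using assms by (simp add: y_def a_def field_simps)
  then have "K * (ln a + y / a) = K * ln a + (2 + 4 * s) / (8 * s) + x / 2"
    by (simp add: distrib_left)
  finally have "x \<le> K * ln 8 + (K * ln a + (2 + 4 * s) / (8 * s) + x / 2)"
    using x by (simp add: distrib_left y_def)
  moreover have "x \<le> A + (B + D + x / 2) \<Longrightarrow> x \<le> 2 * (A + B + D)" for A B D
    by (simp add: field_simps)
  ultimately show ?thesis
    unfolding a_def by blast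
qed

text \<open>\<open>N\<close> bounds the number of steps a shortest chain makes at one scale. A
  stretch of \<open>N + 1\<close> cubes of side at most \<open>8 * t\<close> has length at most
  \<open>L * t\<close>, whence the form of \<open>L\<close>.\<close>

locale chained_whitney = whitney \<Omega> Q s
  for \<Omega> :: "(real ^ 'n::finite) set" and Q :: "nat \<Rightarrow> 'n dyadic" and s :: real +
  fixes K N L :: real
  assumes K_pos: "0 < K"
    and chain_dist_le: "\<And>j k. chain_dist Q j k \<le> ereal (K * log_dist Q j k)"
    and N_bound: "\<And>x. 0 \<le> x \<Longrightarrow> x \<le> K * (ln 8 + ln (2 + 4 * s * (x + 1))) \<Longrightarrow> x \<le> N"
  defines L_def: "L \<equiv> 8 * (N + 1) * s"
begin

lemma N_nonneg: "0 \<le> N"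
proof (rule N_bound)
  have "0 \<le> ln (2 + 4 * s * (0 + 1))" using s_ge by (intro ln_ge_zero) simp
  then show "0 \<le> K * (ln 8 + ln (2 + 4 * s * (0 + 1)))" using K_pos by simp
qed simp

lemma L_ge: "8 \<le> L"
proof -
  have "8 * 1 * 1 \<le> 8 * (N + 1) * s"
    using N_nonneg s_ge by (intro mult_mono) auto
  then show ?thesis by (simp add: L_def)
qed

text \<open>The sides differ by at most the factor 8, and their sum is at least
  \<open>2 * A\<close>, which cancels against the bound on the distance.\<close>

lemma log_dist_le:
  assumes "l j \<le> 8 * A" "A \<le> l j" "l k \<le> 8 * A" "A \<le> l k" "setdist (q j) (q k) \<le> 2 * A * B" "0 < A" "0 \<le> B"
  shows "log_dist Q j k \<le> ln 8 + ln (2 + B)"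
proof -
  have "ln (l j / l k) \<le> ln 8" "ln (l k / l j) \<le> ln 8"
    using assms by (auto simp: divide_simps)
  moreover have "ln (l k / l j) = - ln (l j / l k)" by (simp add: ln_div)
  ultimately have "\<bar>ln (l j / l k)\<bar> \<le> ln 8" by linarith
  moreover have "setdist (q j) (q k) / (l j + l k) \<le> (2 * A * B) / (2 * A)"
    using assms by (intro frac_le) auto
  then have "setdist (q j) (q k) / (l j + l k) + 2 \<le> 2 + B" using assms by simp
  moreover have "0 \<le> setdist (q j) (q k) / (l j + l k)" by (simp add: setdist_pos_le less_imp_le)
  then have "ln (setdist (q j) (q k) / (l j + l k) + 2) \<le> ln (2 + B)"
    using calculation by simp
  ultimately show ?thesis unfolding log_dist_def by linarith
qed

section \<open>Shortest chains\<close>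

definition geodesic :: "(nat \<Rightarrow> nat) \<Rightarrow> nat \<Rightarrow> bool" where
  "geodesic g m \<longleftrightarrow> (\<forall>i<m. (g i, g (Suc i)) \<in> adjacency) \<and> (\<forall>m'. (g 0, g m) \<in> adjacency ^^ m' \<longrightarrow> m \<le> m')"

lemma geodesic_exists:
  obtains g m where "geodesic g m" "g 0 = j" "g m = k"
proof -
  obtain m0 where m0: "(j, k) \<in> adjacency ^^ m0"
    using chain_dist_leD[OF chain_dist_le] by metis
  define m where "m = (LEAST m. (j, k) \<in> adjacency ^^ m)"
  have "(j, k) \<in> adjacency ^^ m" unfolding m_def using m0 by (rule LeastI)
  then obtain g where "g 0 = j" "g m = k" "\<forall>i<m. (g i, g (Suc i)) \<in> adjacency"
    unfolding relpow_fun_conv by blast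
  moreover have "m \<le> m'" if "(j, k) \<in> adjacency ^^ m'" for m'
    unfolding m_def using that by (rule Least_le)
  ultimately show thesis using that[of g m] unfolding geodesic_def by blast
qed

lemma geodesic_sub_relpow:
  assumes "geodesic g m" "a \<le> b" "b \<le> m"
  shows "(g a, g b) \<in> adjacency ^^ (b - a)"
  unfolding relpow_fun_conv
  using assms unfolding geodesic_def by (intro exI[of _ "\<lambda>i. g (a + i)"]) auto

text \<open>Replacing the piece from \<open>a\<close> to \<open>b\<close> by a shorter chain would
  shorten the whole.\<close>

lemma geodesic_sub_le:
  assumes g: "geodesic g m" and ab: "a \<le> b" "b \<le> m" and m': "(g a, g b) \<in> adjacency ^^ m'"
  shows "b - a \<le> m'"
proof -
  have "(g 0, g a) \<in> adjacency ^^ a" "(g b, g m) \<in> adjacency ^^ (m - b)"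
    using geodesic_sub_relpow[OF g, of 0 a] geodesic_sub_relpow[OF g, of b m] ab by auto
  then have "(g 0, g m) \<in> adjacency ^^ (a + m' + (m - b))"
    using m' unfolding relpow_add by blast
  then have "m \<le> a + m' + (m - b)" using g unfolding geodesic_def by blast
  then show ?thesis using ab by linarith
qed

text \<open>The discrete form of the Gehring--Osgood argument: the hypothesis on the chain
  distance bounds the number of cubes a geodesic spends at one scale.\<close>

lemma geodesic_length_at_scale:
  assumes g: "geodesic g m" and ab: "a \<le> b" "b \<le> m"
    and T: "\<And>i. a \<le> i \<Longrightarrow> i \<le> b \<Longrightarrow> l (g i) \<le> T" "T \<le> 8 * l (g a)" "T \<le> 8 * l (g b)"
  shows "real (b - a) \<le> N"
proof (rule N_bound)
  let ?x = "real (b - a)"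
  have T0: "0 < T" using T(1)[of a] ab side_pos[of "Q (g a)"] by linarith
  obtain m' where m': "(g a, g b) \<in> adjacency ^^ m'" "real m' \<le> K * log_dist Q (g a) (g b)"
    using chain_dist_leD[OF chain_dist_le] .
  have "dist (c (g a)) (c (g b)) \<le> (?x + 1) * s * T"
    by (rule dist_relpow_le[where g = g])
      (use T ab g in \<open>auto simp: geodesic_def centre_in_cube\<close>)
  \<comment> \<open>The form required by \<open>log_dist_le\<close> with \<open>T / 8\<close> for
    the scale. The length \<open>?x\<close> now bounds itself through a logarithm, which is the
    hypothesis of \<open>N_bound\<close>.\<close>
  then have "setdist (q (g a)) (q (g b)) \<le> 2 * (T / 8) * (4 * s * (?x + 1))"
    unfolding mult.commute[of "?x + 1"]
    using setdist_le_dist[OF centre_in_cube centre_in_cube, of "Q (g a)" "Q (g b)"] by (simp add: algebra_simps)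
  then have "log_dist Q (g a) (g b) \<le> ln 8 + ln (2 + 4 * s * (?x + 1))"
    using T T0 ab s_ge by (intro log_dist_le[where A = "T / 8"]) auto
  then have "K * log_dist Q (g a) (g b) \<le> K * (ln 8 + ln (2 + 4 * s * (?x + 1)))"
    using K_pos by simp
  moreover have "b - a \<le> m'" using geodesic_sub_le[OF g ab m'(1)] .
  then have "?x \<le> real m'" by linarith
  ultimately show "?x \<le> K * (ln 8 + ln (2 + 4 * s * (?x + 1)))"
    using m'(2) by linarith
qed simp

text \<open>Induction on \<open>p\<close>, each time with the first cube whose side reaches the
  scale. Between the first cubes of two successive scales \<open>t\<close> and \<open>2 * t\<close>
  all sides are at most \<open>8 * t\<close> and both ends at least \<open>t\<close>, so this
  stretch contributes at most \<open>L * t\<close>; added to \<open>L * t\<close> from the induction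
  hypothesis this is \<open>L\<close> times the doubled scale.\<close>

lemma geodesic_reaches_scale:
  assumes g: "geodesic g m" and p: "2 ^ p * l (g 0) \<le> l (g m)"
  shows "\<exists>i\<le>m. 2 ^ p * l (g 0) \<le> l (g i) \<and> l (g i) \<le> 4 * (2 ^ p * l (g 0)) \<and>
    (\<forall>i'<i. l (g i') < 2 ^ p * l (g 0)) \<and>
    (\<forall>x\<in>q (g 0). \<forall>y\<in>q (g i). dist x y \<le> L * (2 ^ p * l (g 0)))"
  using p
proof (induction p)
  case 0
  have "dist x y \<le> L * l (g 0)" if "x \<in> q (g 0)" "y \<in> q (g 0)" for x y
  proof -
    have "dist x y \<le> s * l (g 0)" using that unfolding s_def by (rule dist_cube_le)
    also have "1 * s \<le> 8 * (N + 1) * s" using N_nonneg s_ge by (intro mult_right_mono) auto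
    then have "s * l (g 0) \<le> L * l (g 0)" unfolding L_def by (intro mult_right_mono) (auto simp: less_imp_le)
    finally show ?thesis .
  qed
  then show ?case by (intro exI[of _ 0]) (auto simp: less_imp_le)
next
  case (Suc p)
  let ?t = "2 ^ p * l (g 0)"
  have t0: "0 < ?t" by simp
  have tm: "2 * ?t \<le> l (g m)" using Suc.prems by simp
  obtain i where i: "i \<le> m" "?t \<le> l (g i)" "\<forall>i'<i. l (g i') < ?t"
    "\<forall>x\<in>q (g 0). \<forall>y\<in>q (g i). dist x y \<le> L * ?t"
    using Suc.IH tm t0 by auto
  define i' where "i' = (LEAST i'. 2 * ?t \<le> l (g i'))"
  have i'1: "2 * ?t \<le> l (g i')" unfolding i'_def using tm by (rule LeastI)
  have i'm: "i' \<le> m" unfolding i'_def using tm by (rule Least_le)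
  have i'2: "l (g u) < 2 * ?t" if "u < i'" for u
    using not_less_Least[OF that[unfolded i'_def]] by simp
  have ii': "i \<le> i'"
  proof (rule ccontr)
    assume "\<not> i \<le> i'"
    then have "l (g i') < ?t" using i(3) by simp
    then show False using i'1 t0 by linarith
  qed
  have "i' \<noteq> 0"
  proof
    assume "i' = 0"
    then have "2 * ?t \<le> l (g 0)" using i'1 by simp
    moreover have "1 * l (g 0) \<le> ?t" by (intro mult_right_mono) (auto simp: less_imp_le)
    ultimately show False using side_pos[of "Q (g 0)"] by linarith
  qed
  then obtain u where u: "i' = Suc u" using not0_implies_Suc by blast
  \<comment> \<open>The predecessor of the first large cube is still small, and neighbours differ in
    side by at most the factor 4, so the overshoot is bounded.\<close>
  have "(g u, g i') \<in> adjacency" using g u i'm unfolding geodesic_def by auto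
  then have "l (g i') \<le> 4 * l (g u)" using side_adjacent unfolding adjacency_def by blast
  then have i'3: "l (g i') \<le> 4 * (2 * ?t)" using i'2[of u] u by linarith
  have T: "l (g v) \<le> 8 * ?t" if "v \<le> i'" for v
    using i'2[of v] i'3 t0 that by (cases "v = i'") (simp, linarith)
  have len: "real (i' - i) \<le> N"
    by (rule geodesic_length_at_scale[OF g ii' i'm, of "8 * ?t"]) (use T i(2) i'1 t0 in \<open>auto simp del: zero_less_mult_iff, linarith?\<close>)
  have "dist x y \<le> L * (2 * ?t)" if "x \<in> q (g 0)" "y \<in> q (g i')" for x y
  proof -
    have "dist (c (g i)) y \<le> (real (i' - i) + 1) * s * (8 * ?t)"
      by (rule dist_relpow_le[where g = g])
        (use T ii' i'm g that in \<open>auto simp: geodesic_def centre_in_cube\<close>)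
    also have "\<dots> \<le> (N + 1) * s * (8 * ?t)"
      using len s_ge by (intro mult_right_mono) (auto simp: less_imp_le)
    also have "\<dots> = L * ?t" by (simp add: L_def)
    finally have "dist (c (g i)) y \<le> L * ?t" .
    moreover have "dist x (c (g i)) \<le> L * ?t" using i(4) that centre_in_cube by blast
    ultimately show ?thesis using dist_triangle[of x y "c (g i)"] by (simp add: algebra_simps)
  qed
  then show ?case using i'1 i'2 i'3 i'm by (intro exI[of _ i']) (auto simp: mult_ac)
qed

text \<open>The cube \<open>k\<close> gives an end for a shortest chain, which must pass through all
  intermediate sizes. The scale \<open>t\<close> is rounded down to a power of two times
  \<open>l j\<close>, which costs the factor 2 in the lower bound.\<close>

lemma cube_at_scale:
  assumes "l j \<le> t" "t \<le> l k"
  obtains i where "t / 2 \<le> l i" "l i \<le> 4 * t" "\<And>x y. x \<in> q j \<Longrightarrow> y \<in> q i \<Longrightarrow> dist x y \<le> L * t"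
proof -
  obtain g m where g: "geodesic g m" "g 0 = j" "g m = k" by (rule geodesic_exists)
  have ex: "\<exists>n. t / l j < 2 ^ n" by (rule real_arch_pow) simp
  define n where "n = (LEAST n. t / l j < 2 ^ n)"
  have n1: "t / l j < 2 ^ n" unfolding n_def using ex by (rule LeastI_ex)
  have "1 \<le> t / l j" using assms by (simp add: pos_le_divide_eq)
  then have "n \<noteq> 0" using n1 by (intro notI) simp
  then obtain p where p: "n = Suc p" using not0_implies_Suc by blast
  have "\<not> t / l j < 2 ^ p" by (rule not_less_Least[of p "\<lambda>n. t / l j < 2 ^ n", folded n_def]) (simp add: p)
  then have p1: "2 ^ p * l j \<le> t" by (simp add: not_less pos_le_divide_eq)
  have p2: "t < 2 * (2 ^ p * l j)" using n1 p by (simp add: pos_divide_less_eq)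
  obtain i where i: "2 ^ p * l j \<le> l i" "l i \<le> 4 * (2 ^ p * l j)"
    "\<forall>x\<in>q j. \<forall>y\<in>q i. dist x y \<le> L * (2 ^ p * l j)"
    using geodesic_reaches_scale[OF g(1), of p] g p1 assms by auto
  have "L * (2 ^ p * l j) \<le> L * t" using p1 L_ge by (intro mult_left_mono) auto
  then have "dist x y \<le> L * t" if "x \<in> q j" "y \<in> q i" for x y
    using i(3) that by fastforce
  moreover have "t / 2 \<le> l i" "l i \<le> 4 * t" using i p1 p2 by linarith+
  ultimately show thesis using that[of i] by blast
qed

end

section \<open>Counting shadows of cubes\<close>

definition vol :: "nat \<Rightarrow> real \<Rightarrow> real" where
  "vol n r = unit_ball_vol (real n) * r ^ n"

lemma vol_pos: "0 < r \<Longrightarrow> 0 < vol n r"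
  by (simp add: vol_def)

lemma vol_nonneg: "0 \<le> r \<Longrightarrow> 0 \<le> vol n r"
  by (simp add: vol_def)

lemma vol_mono: "0 \<le> r \<Longrightarrow> r \<le> r' \<Longrightarrow> vol n r \<le> vol n r'"
  by (simp add: vol_def mult_left_mono power_mono)

lemma vol_mult: "vol n (a * r) = a ^ n * vol n r"
  by (simp add: vol_def power_mult_distrib)

lemma emeasure_lebesgue_cball:
  fixes x :: "real ^ 'n::finite"
  assumes "0 \<le> r"
  shows "emeasure lebesgue (cball x r) = ennreal (vol CARD('n) r)"
  using emeasure_cball[OF assms, of x] by (simp add: vol_def)

lemma ln_le_four_mult:
  fixes y :: real
  assumes "0 < y" "y \<le> 16 ^ n"
  shows "ln y \<le> 4 * real n"
proof -
  have "ln y \<le> ln (16 ^ n)" using assms by simp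
  also have "\<dots> = real n * ln (2 ^ 4)" by (simp add: ln_realpow)
  also have "ln (2 ^ 4) = 4 * ln (2::real)" by (subst ln_realpow) auto
  also have "real n * (4 * ln 2) \<le> real n * (4 * 1)"
    using ln_le_minus_one[of "2::real"] by (intro mult_left_mono) auto
  finally show ?thesis by simp
qed

text \<open>A cube of side at least \<open>t0\<close> is a target for chains at every scale up to
  \<open>t0\<close>; a bounded domain has no cubes beyond some size.\<close>

locale porous_whitney = chained_whitney \<Omega> Q s K N L
  for \<Omega> :: "(real ^ 'n::finite) set" and Q :: "nat \<Rightarrow> 'n dyadic" and s K N L :: real +
  fixes t0 :: real
  assumes large_cube: "\<exists>k. t0 \<le> l k"
begin

lemma cube_at_scale_centre:
  assumes "l j \<le> t" "t \<le> t0" "z \<in> q j"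
  obtains i where "t / 2 \<le> l i" "l i \<le> 4 * t" "dist z (c i) \<le> L * t"
proof -
  obtain k where "t \<le> l k" using large_cube assms(2) order_trans by blast
  from cube_at_scale[OF assms(1) this] show thesis
    using that assms(3) centre_in_cube by metis
qed

text \<open>
  For the ball of centre \<open>x0\<close> and radius \<open>r\<close>; the constants are those with which the cubes of
  \<open>cube_at_scale_centre\<close>, for all scales up to \<open>r\<close>, shadow a given point of the ball.
\<close>

definition shadow :: "real ^ 'n \<Rightarrow> real \<Rightarrow> nat \<Rightarrow> (real ^ 'n) set" where
  "shadow x0 r j = (if l j \<le> 4 * r \<and> dist (c j) x0 \<le> (L + 2) * r then cball (c j) (2 * (L + 1) * l j) else {})"

definition shadow_count :: "real ^ 'n \<Rightarrow> real \<Rightarrow> real ^ 'n \<Rightarrow> ennreal" where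
  "shadow_count x0 r x = (\<Sum>j. indicator (shadow x0 r j) x)"

lemma shadow_sets [measurable]: "shadow x0 r j \<in> sets lebesgue"
  by (simp add: shadow_def)

lemma shadow_count_measurable [measurable]: "shadow_count x0 r \<in> borel_measurable lebesgue"
  unfolding shadow_count_def by measurable

text \<open>There is one cube for each of the scales \<open>16 ^ p * \<delta>\<close> up to
  \<open>r\<close>, and each of these cubes shadows \<open>x\<close>. The number of such scales
  bounds the logarithm, up to the factor 4 that bounds ln 16.\<close>

lemma ln_le_shadow_count:
  assumes z: "z \<in> q j" "dist z x \<le> \<delta>" "l j \<le> \<delta>" and x: "dist x x0 \<le> r" and r: "r \<le> t0"
  shows "ennreal (ln (r / \<delta>)) \<le> 4 * shadow_count x0 r x"
proof (cases "\<delta> \<le> r")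
  case False
  have "0 \<le> r" using x zero_le_dist order_trans by blast
  moreover have "\<delta> > 0" using z(3) side_pos[of "Q j"] by linarith
  ultimately have "ln (r / \<delta>) \<le> 0" using False ln_le_minus_one[of "r / \<delta>"]
    by (cases "r = 0") (auto simp: field_simps)
  then show ?thesis by (simp add: ennreal_neg)
next
  case True
  have \<delta>: "0 < \<delta>" using z(3) side_pos[of "Q j"] by linarith
  define n where "n = (LEAST n. r / \<delta> < 16 ^ n)"
  have n1: "r / \<delta> < 16 ^ n" unfolding n_def by (rule LeastI_ex, rule real_arch_pow) simp
  have n2: "16 ^ p * \<delta> \<le> r" if "p < n" for p
    using not_less_Least[OF that[unfolded n_def]] \<delta> by (simp add: not_less pos_le_divide_eq)
  have n3: "\<delta> \<le> 16 ^ p * \<delta>" for p :: nat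
    using \<delta> by simp
  have "\<exists>i. 16 ^ p * \<delta> / 2 \<le> l i \<and> l i \<le> 4 * (16 ^ p * \<delta>) \<and> dist z (c i) \<le> L * (16 ^ p * \<delta>)" if "p < n" for p
  proof -
    have "l j \<le> 16 ^ p * \<delta>" "16 ^ p * \<delta> \<le> t0"
      using n2[OF that] n3[of p] z(3) r by linarith+
    from cube_at_scale_centre[OF this z(1)] show ?thesis by blast
  qed
  then obtain i where i: "\<And>p. p < n \<Longrightarrow> 16 ^ p * \<delta> / 2 \<le> l (i p)" "\<And>p. p < n \<Longrightarrow> l (i p) \<le> 4 * (16 ^ p * \<delta>)"
     "\<And>p. p < n \<Longrightarrow> dist z (c (i p)) \<le> L * (16 ^ p * \<delta>)"
    by metis
  \<comment> \<open>A cube chosen at one scale has side at most 4 times that scale, one chosen at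
    the next scale at least 16 / 2 = 8 times it. The ratio 16 keeps them apart.\<close>
  have "i p \<noteq> i p'" if "p < p'" "p' < n" for p p'
  proof
    assume eq: "i p = i p'"
    have "(16::real) ^ Suc p \<le> 16 ^ p'" using that by (intro power_increasing) auto
    then have "16 ^ Suc p * \<delta> \<le> 16 ^ p' * \<delta>" using \<delta> by (intro mult_right_mono) auto
    then have "16 * (16 ^ p * \<delta>) \<le> 16 ^ p' * \<delta>" by simp
    moreover have "0 < 16 ^ p * \<delta>" using \<delta> by simp
    ultimately show False using i(1)[of p'] i(2)[of p] that eq by simp
  qed
  then have inj: "inj_on i {..<n}"
    by (intro inj_onI) (metis lessThan_iff nat_neq_iff)
  \<comment> \<open>The constants of \<open>shadow\<close> come from here. From \<open>z\<close> to
    the centre is at most \<open>L * ?t\<close>, from \<open>x\<close> to \<open>z\<close> at most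
    \<delta>, from \<open>x\<close> to \<open>x0\<close> at most \<open>r\<close>, and \<delta>
    \<le> \<open>?t\<close> \<le> \<open>r\<close>; this gives \<open>L + 2\<close>. The other
    constant arises from \<open>?t\<close> \<le> \<open>2 * l (i p)\<close>.\<close>
  have mem: "x \<in> shadow x0 r (i p)" if p: "p < n" for p
  proof -
    let ?t = "16 ^ p * \<delta>"
    have "dist (c (i p)) x \<le> L * ?t + \<delta>"
      using dist_triangle[of "c (i p)" x z] i(3)[OF p] z(2) by (simp add: dist_commute)
    moreover have Lt: "L * ?t \<le> L * r" using L_ge n2[OF p] by (intro mult_left_mono) auto
    ultimately have "dist (c (i p)) x0 \<le> (L + 2) * r"
      using dist_triangle[of "c (i p)" x0 x] x True by (simp add: algebra_simps)
    moreover have "l (i p) \<le> 4 * r" using i(2)[OF p] n2[OF p] by simp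
    moreover have "dist (c (i p)) x \<le> 2 * (L + 1) * l (i p)"
    proof -
      have "dist (c (i p)) x \<le> (L + 1) * ?t"
        using \<open>dist (c (i p)) x \<le> L * ?t + \<delta>\<close> n3[of p] by (simp add: algebra_simps)
      also have "\<dots> \<le> (L + 1) * (2 * l (i p))"
        using i(1)[OF p] L_ge by (intro mult_left_mono) auto
      finally show ?thesis by (simp add: algebra_simps)
    qed
    ultimately show ?thesis by (simp add: shadow_def)
  qed
  have "of_nat n = (\<Sum>p<n. indicator (shadow x0 r (i p)) x :: ennreal)"
    using mem by simp
  also have "\<dots> = (\<Sum>k\<in>i ` {..<n}. indicator (shadow x0 r k) x)"
    using inj by (simp add: sum.reindex)
  also have "\<dots> \<le> shadow_count x0 r x"
    unfolding shadow_count_def by (rule sum_le_suminf) auto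
  finally have count: "of_nat n \<le> shadow_count x0 r x" .
  have "ennreal (ln (r / \<delta>)) \<le> ennreal (4 * real n)"
    using ln_le_four_mult[of "r / \<delta>" n] n1 \<delta> True by (intro ennreal_leI) auto
  also have "\<dots> = 4 * of_nat n" by (simp add: ennreal_mult' ennreal_of_nat_eq_real_of_nat)
  also have "\<dots> \<le> 4 * shadow_count x0 r x" using count by (rule mult_left_mono) simp
  finally show ?thesis .
qed

lemma suminf_emeasure_core_le:
  assumes "\<And>j. P j \<Longrightarrow> core j \<subseteq> S" "S \<in> sets lebesgue"
  shows "(\<Sum>j. if P j then emeasure lebesgue (core j) else 0) \<le> emeasure lebesgue S"
proof -
  have "(\<Sum>j. if P j then emeasure lebesgue (core j) else 0) = (\<Sum>j. emeasure lebesgue (if P j then core j else {}))"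
    by (intro suminf_cong) auto
  also have "\<dots> = emeasure lebesgue (\<Union>j. if P j then core j else {})"
  proof (rule suminf_emeasure)
    show "disjoint_family (\<lambda>j. if P j then core j else {})"
      using disjoint_core by (auto simp: disjoint_family_on_def)
  qed auto
  also have "\<dots> \<le> emeasure lebesgue S"
    using assms by (intro emeasure_mono) (auto split: if_splits)
  finally show ?thesis .
qed

text \<open>A nonempty shadow has \<open>8 * (L + 1)\<close> times the radius of the core, so its
  volume is a fixed multiple of the core's. The cores concerned are disjoint and lie in one ball of
  radius \<open>(L + 3) * r\<close>.\<close>

lemma nn_integral_shadow_count_le:
  assumes "0 \<le> r"
  shows "(\<integral>\<^sup>+x. shadow_count x0 r x \<partial>lebesgue) \<le> ennreal ((8 * (L + 1)) ^ CARD('n) * vol CARD('n) ((L + 3) * r))"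
proof -
  let ?P = "\<lambda>j. l j \<le> 4 * r \<and> dist (c j) x0 \<le> (L + 2) * r"
  let ?A = "ennreal ((8 * (L + 1)) ^ CARD('n))"
  have "(\<integral>\<^sup>+x. shadow_count x0 r x \<partial>lebesgue) = (\<Sum>j. emeasure lebesgue (shadow x0 r j))"
    unfolding shadow_count_def by (subst nn_integral_suminf) auto
  also have "\<dots> = (\<Sum>j. ?A * (if ?P j then emeasure lebesgue (core j) else 0))"
  proof (rule suminf_cong)
    fix j
    have "vol CARD('n) (2 * (L + 1) * l j) = (8 * (L + 1)) ^ CARD('n) * vol CARD('n) (l j / 4)"
      by (subst vol_mult[symmetric]) (simp add: algebra_simps)
    then show "emeasure lebesgue (shadow x0 r j) = ?A * (if ?P j then emeasure lebesgue (core j) else 0)"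
      using L_ge unfolding shadow_def
      by (auto simp: emeasure_lebesgue_cball less_imp_le ennreal_mult' vol_nonneg simp del: emeasure_completion)
  qed
  also have "\<dots> = ?A * (\<Sum>j. if ?P j then emeasure lebesgue (core j) else 0)"
    by (rule ennreal_suminf_cmult)
  also have "\<dots> \<le> ?A * emeasure lebesgue (cball x0 ((L + 3) * r))"
  proof (intro mult_left_mono suminf_emeasure_core_le)
    fix j assume P: "?P j"
    show "core j \<subseteq> cball x0 ((L + 3) * r)"
    proof
      fix y assume "y \<in> core j"
      then have "dist x0 y \<le> (L + 2) * r + l j / 4"
        using P dist_triangle[of x0 y "c j"] by (simp add: dist_commute)
      then show "y \<in> cball x0 ((L + 3) * r)" using P by (simp add: algebra_simps)
    qed
  qed auto
  also have "\<dots> = ennreal ((8 * (L + 1)) ^ CARD('n) * vol CARD('n) ((L + 3) * r))"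
    using assms L_ge by (subst emeasure_lebesgue_cball) (auto simp: ennreal_mult')
  finally show ?thesis .
qed

text \<open>For a cube \<open>k\<close> of side about \<open>A\<close> and a cube \<open>j\<close>
  not much larger, at distance of order \<open>A\<close>, the only unbounded term records how much
  smaller than \<open>A\<close> the cube \<open>j\<close> is.\<close>

lemma log_dist_le_ln:
  assumes j: "l j \<le> 12 * A" and k: "A / 2 \<le> l k" "l k \<le> 4 * A" and A: "0 < A"
    and d: "dist (c j) (c k) \<le> B * A"
  shows "log_dist Q j k \<le> ln (A / l j) + 12 + 2 * B"
proof -
  have B: "0 \<le> B" using d A zero_le_dist[of "c j" "c k"] by (metis mult_less_0_iff not_less order_trans)
  have "\<bar>ln (l j / l k)\<bar> \<le> \<bar>ln (l j / A)\<bar> + \<bar>ln (l k / A)\<bar>"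
  proof -
    have "ln (l j / l k) = ln (l j / A) - ln (l k / A)"
      using A by (simp add: ln_div less_imp_neq[OF side_pos, symmetric])
    then show ?thesis by linarith
  qed
  moreover have "\<bar>ln (l k / A)\<bar> \<le> 2"
  proof -
    have "ln (1 / 2) \<le> ln (l k / A)" "ln (l k / A) \<le> ln (2 * 2)"
      using k A by (simp_all add: field_simps)
    moreover have "ln (1 / 2) = - ln (2::real)" "ln (2 * 2) = ln 2 + ln (2::real)"
      by (simp add: ln_div, subst ln_mult) auto
    ultimately show ?thesis
      using ln_le_minus_one[of "2::real"] by linarith
  qed
  \<comment> \<open>Here y = \<open>ln (l j / A)\<close> is at most 4, since 12 \<le> 16, and y
    \<le> 4 gives |y| \<le> 8 - y.\<close>
  moreover have "\<bar>ln (l j / A)\<bar> \<le> ln (A / l j) + 8"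
  proof -
    have "ln (l j / A) \<le> 4 * real 1" using j A by (intro ln_le_four_mult) (auto simp: field_simps)
    moreover have "ln (A / l j) = - ln (l j / A)" using A by (simp add: ln_div)
    ultimately show ?thesis by linarith
  qed
  moreover have "ln (setdist (q j) (q k) / (l j + l k) + 2) \<le> 2 * B + 1"
  proof -
    have "setdist (q j) (q k) \<le> B * A"
      using setdist_le_dist[OF centre_in_cube centre_in_cube] d order_trans by blast
    have "setdist (q j) (q k) / (l j + l k) \<le> (B * A) / (A / 2)"
    proof (rule frac_le)
      show "A / 2 \<le> l j + l k" using k side_pos[of "Q j"] by linarith
    qed (use A B \<open>setdist (q j) (q k) \<le> B * A\<close> in auto)
    then have "setdist (q j) (q k) / (l j + l k) + 2 \<le> 2 * B + 2" using A by simp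
    moreover have "0 \<le> setdist (q j) (q k) / (l j + l k)" by (simp add: setdist_pos_le less_imp_le)
    ultimately show ?thesis
      using ln_le_minus_one[of "setdist (q j) (q k) / (l j + l k) + 2"] by linarith
  qed
  ultimately show ?thesis unfolding log_dist_def by linarith
qed

end

section \<open>Averages over Whitney cubes\<close>

lemma set_integrable_imp_measurable: "set_integrable M B f \<Longrightarrow> set_borel_measurable M B f"
  by (simp add: set_integrable_def set_borel_measurable_def)

lemma measurable_abs_diff_indicator:
  fixes f :: "'a \<Rightarrow> real"
  assumes "set_borel_measurable M B f" "B \<in> sets M"
  shows "(\<lambda>y. ennreal \<bar>f y - m\<bar> * indicator B y) \<in> borel_measurable M"
proof -
  have "(\<lambda>y. indicator B y * f y) \<in> borel_measurable M"
    using assms(1) by (simp add: set_borel_measurable_def)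
  then have "(\<lambda>y. ennreal \<bar>indicator B y * f y - m\<bar> * indicator B y) \<in> borel_measurable M"
    using assms(2) by measurable
  also have "(\<lambda>y. ennreal \<bar>indicator B y * f y - m\<bar> * indicator B y) = (\<lambda>y. ennreal \<bar>f y - m\<bar> * indicator B y)"
    by (auto split: split_indicator)
  finally show ?thesis .
qed

text \<open>Passing from a ball \<open>B\<close> to a set \<open>A\<close> inside it costs the ratio
  of their volumes.\<close>

lemma average_dist_le:
  fixes f :: "'a::euclidean_space \<Rightarrow> real"
  assumes int: "set_integrable lebesgue B f" and A: "A \<subseteq> B" "A \<in> sets lebesgue" "emeasure lebesgue A = ennreal a" "0 < a"
    and D: "(\<integral>\<^sup>+y\<in>B. ennreal \<bar>f y - m\<bar> \<partial>lebesgue) \<le> ennreal D" "0 \<le> D"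
  shows "\<bar>average A f - m\<bar> \<le> D / a"
proof -
  have fA: "integrable lebesgue (\<lambda>y. indicator A y * f y)"
    using set_integrable_subset[OF int A(2,1)] by (simp add: set_integrable_def)
  have mA: "integrable lebesgue (\<lambda>y. indicator A y * m)"
    using A by (intro integrable_mult_left integrable_real_indicator) auto
  have ma: "measure lebesgue A = a"
    using A by (intro measure_eq_emeasure_eq_ennreal) auto
  let ?I = "LINT y|lebesgue. indicator A y * f y - indicator A y * m"
  have "?I = (LINT y|lebesgue. indicator A y * f y) - a * m"
    using fA mA ma A by simp
  then have eq: "average A f - m = ?I / a"
    using A(4) by (simp add: average_def set_lebesgue_integral_def ma field_simps)
  have "ennreal (norm ?I) \<le> (\<integral>\<^sup>+y. norm (indicator A y * f y - indicator A y * m) \<partial>lebesgue)"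
    using fA mA by (intro integral_norm_bound_ennreal Bochner_Integration.integrable_diff)
  also have "\<dots> \<le> (\<integral>\<^sup>+y\<in>B. ennreal \<bar>f y - m\<bar> \<partial>lebesgue)"
    using A(1) by (intro nn_integral_mono) (auto split: split_indicator)
  also note D(1)
  finally have "\<bar>?I\<bar> \<le> D" using D(2) by simp
  then show ?thesis using A(4) unfolding eq by (simp add: divide_right_mono)
qed

lemma nn_integral_dist_shift:
  fixes f :: "'a \<Rightarrow> real"
  assumes "set_borel_measurable M B f" "B \<in> sets M" "emeasure M B = ennreal b"
  shows "(\<integral>\<^sup>+y\<in>B. ennreal \<bar>f y - m\<bar> \<partial>M) \<le> (\<integral>\<^sup>+y\<in>B. ennreal \<bar>f y - m'\<bar> \<partial>M) + ennreal (\<bar>m' - m\<bar> * b)"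
proof -
  have "(\<integral>\<^sup>+y\<in>B. ennreal \<bar>f y - m\<bar> \<partial>M)
      \<le> (\<integral>\<^sup>+y. ennreal \<bar>f y - m'\<bar> * indicator B y + ennreal \<bar>m' - m\<bar> * indicator B y \<partial>M)"
    by (intro nn_integral_mono)
      (auto split: split_indicator simp flip: ennreal_plus intro!: ennreal_leI)
  also have "\<dots> = (\<integral>\<^sup>+y\<in>B. ennreal \<bar>f y - m'\<bar> \<partial>M) + (\<integral>\<^sup>+y. ennreal \<bar>m' - m\<bar> * indicator B y \<partial>M)"
    using assms by (intro nn_integral_add measurable_abs_diff_indicator[OF assms(1,2)]) auto
  also have "(\<integral>\<^sup>+y. ennreal \<bar>m' - m\<bar> * indicator B y \<partial>M) = ennreal (\<bar>m' - m\<bar> * b)"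
    using assms by (simp add: nn_integral_cmult_indicator ennreal_mult')
  finally show ?thesis .
qed

text \<open>The average may be replaced by any number \<open>m\<close> at the cost of a factor 2;
  the later estimates take a mean over a nearby cube, or zero.\<close>

lemma nn_integral_dist_average_le:
  fixes f :: "'a::euclidean_space \<Rightarrow> real"
  assumes int: "set_integrable lebesgue B f" and B: "B \<in> sets lebesgue" "emeasure lebesgue B = ennreal b" "0 < b"
    and D: "(\<integral>\<^sup>+y\<in>B. ennreal \<bar>f y - m\<bar> \<partial>lebesgue) \<le> ennreal (D * b)" "0 \<le> D"
  shows "(\<integral>\<^sup>+y\<in>B. ennreal \<bar>f y - average B f\<bar> \<partial>lebesgue) \<le> ennreal (2 * D * b)"
proof -
  have "\<bar>average B f - m\<bar> \<le> D * b / b"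
    using B D by (intro average_dist_le[OF int subset_refl]) auto
  then have "ennreal (\<bar>m - average B f\<bar> * b) \<le> ennreal (D * b)"
    using B by (intro ennreal_leI mult_right_mono) auto
  with nn_integral_dist_shift[OF set_integrable_imp_measurable[OF int] B(1,2), of "average B f" m] D
  have "(\<integral>\<^sup>+y\<in>B. ennreal \<bar>f y - average B f\<bar> \<partial>lebesgue) \<le> ennreal (D * b) + ennreal (D * b)"
    by (meson add_mono order_trans)
  also have "\<dots> = ennreal (2 * D * b)" using B D by (simp flip: ennreal_plus)
  finally show ?thesis .
qed

text \<open>\<open>F\<close> is any positive real that bounds both parts of the norm. This keeps the
  estimates among the reals and includes functions of norm zero.\<close>

locale bmo_on_whitney = porous_whitney \<Omega> Q s K N L t0
  for \<Omega> :: "(real ^ 'n::finite) set" and Q :: "nat \<Rightarrow> 'n dyadic" and s K N L t0 :: real +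
  fixes f :: "real ^ 'n \<Rightarrow> real" and F r0 :: real
  assumes f_integrable: "\<And>S. compact S \<Longrightarrow> S \<subseteq> \<Omega> \<Longrightarrow> set_integrable lebesgue S f"
    and F_pos: "0 < F" and r0_pos: "0 < r0"
    and oscillation_le: "\<And>x r. 0 < r \<Longrightarrow> cball x r \<subseteq> \<Omega> \<Longrightarrow>
      (\<integral>\<^sup>+y\<in>cball x r. ennreal \<bar>f y - average (cball x r) f\<bar> \<partial>lebesgue) \<le> ennreal (F * vol CARD('n) r)"
    and local_le: "\<And>x. (\<integral>\<^sup>+y\<in>cball x r0 \<inter> \<Omega>. ennreal \<bar>f y\<bar> \<partial>lebesgue) \<le> ennreal F"
begin

definition mean :: "nat \<Rightarrow> real" where
  "mean j = average (core j) f"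

lemma emeasure_core: "emeasure lebesgue (core j) = ennreal (vol CARD('n) (l j / 4))"
  by (simp add: emeasure_lebesgue_cball less_imp_le del: emeasure_completion)

lemma mean_dist_cball:
  assumes "core j \<subseteq> cball x r" "cball x r \<subseteq> \<Omega>" "r \<le> a * (l j / 4)" "0 < r"
  shows "\<bar>mean j - average (cball x r) f\<bar> \<le> F * a ^ CARD('n)"
proof -
  have "\<bar>mean j - average (cball x r) f\<bar> \<le> (F * vol CARD('n) r) / vol CARD('n) (l j / 4)"
    unfolding mean_def
    by (rule average_dist_le[OF f_integrable _ _ emeasure_core _ oscillation_le])
      (use assms F_pos in \<open>auto simp: vol_pos vol_nonneg\<close>)
  also have "\<dots> \<le> (F * vol CARD('n) (a * (l j / 4))) / vol CARD('n) (l j / 4)"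
    using assms F_pos by (intro divide_right_mono mult_left_mono vol_mono) (auto simp: vol_nonneg less_imp_le)
  also have "\<dots> = F * a ^ CARD('n)"
    using vol_pos[of "l j / 4" "CARD('n)"] unfolding vol_mult by simp
  finally show ?thesis .
qed

definition adjacency_const :: real where "adjacency_const = 2 * (8 * s + 4) ^ CARD('n)"

lemma adjacency_const_pos: "0 < adjacency_const"
  using s_ge by (simp add: adjacency_const_def)

text \<open>Both means are compared with the average over one ball around a common point of the two
  cubes. It contains both cores, stays in \<Omega>, and has at most \<open>8 * s + 4\<close> times
  the radius of either core.\<close>

lemma mean_adjacent_aux:
  assumes "(i, j) \<in> adjacency" "l j \<le> l i"
  shows "\<bar>mean i - mean j\<bar> \<le> adjacency_const * F"
proof -
  obtain z where z: "z \<in> q i" "z \<in> q j" using assms unfolding adjacency_def by auto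
  \<comment> \<open>From \<open>z\<close> to the centre is at most \<open>s / 2\<close> sides, and
    the core adds a quarter. Since \<open>s\<close> \<ge> 1, the sum is less than \<open>s\<close>
    sides, so the ball avoids the complement.\<close>
  define r where "r = (s / 2 + 1 / 4) * l i"
  have r: "0 < r" using s_ge by (simp add: r_def add_pos_pos)
  have "r < s * l i"
    unfolding r_def using s_ge by (intro mult_strict_right_mono) auto
  with z have sub: "cball z r \<subseteq> \<Omega>" by (intro cball_subset)
  have core: "core k \<subseteq> cball z r" if "z \<in> q k" "l k \<le> l i" for k
  proof
    fix y assume "y \<in> core k"
    then have "dist z y \<le> (s / 2 + 1 / 4) * l k"
      using dist_c_le[OF that(1)] dist_triangle[of z y "c k"] by (simp add: algebra_simps)
    also have "\<dots> \<le> r" unfolding r_def using that s_ge by (intro mult_left_mono) auto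
    finally show "y \<in> cball z r" by simp
  qed
  have "l i \<le> 4 * l j" using side_adjacent[of j i] z by blast
  have "\<bar>mean k - average (cball z r) f\<bar> \<le> F * (8 * s + 4) ^ CARD('n)" if "z \<in> q k" "l k \<le> l i" "l i \<le> 4 * l k" for k
  proof (rule mean_dist_cball[OF core[OF that(1,2)] sub _ r])
    have "r \<le> (s / 2 + 1 / 4) * (4 * l k)" unfolding r_def using that s_ge by (intro mult_left_mono) auto
    then show "r \<le> (8 * s + 4) * (l k / 4)" by (simp add: algebra_simps)
  qed
  from this[of i] this[of j] z assms \<open>l i \<le> 4 * l j\<close> show ?thesis
    by (simp add: adjacency_const_def less_imp_le algebra_simps)
qed

lemma mean_adjacent:
  assumes "(i, j) \<in> adjacency"
  shows "\<bar>mean i - mean j\<bar> \<le> adjacency_const * F"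
proof (cases "l j \<le> l i")
  case False
  have "(j, i) \<in> adjacency" using assms unfolding adjacency_def by auto
  with False have "\<bar>mean j - mean i\<bar> \<le> adjacency_const * F" by (intro mean_adjacent_aux) auto
  then show ?thesis by linarith
qed (use mean_adjacent_aux assms in blast)

lemma mean_relpow: "(i, j) \<in> adjacency ^^ m \<Longrightarrow> \<bar>mean i - mean j\<bar> \<le> adjacency_const * F * real m"
proof (induction m arbitrary: j)
  case (Suc m)
  then obtain k where k: "(i, k) \<in> adjacency ^^ m" "(k, j) \<in> adjacency" by auto
  then show ?case using Suc.IH[OF k(1)] mean_adjacent[OF k(2)] by (simp add: distrib_left)
qed auto

text \<open>Means change by a bounded amount per step of a chain, and the hypothesis on the chain
  distance makes the number of steps logarithmic.\<close>

lemma mean_diff_le: "\<bar>mean i - mean j\<bar> \<le> adjacency_const * F * (K * log_dist Q i j)"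
proof -
  obtain m where m: "(i, j) \<in> adjacency ^^ m" "real m \<le> K * log_dist Q i j"
    using chain_dist_leD[OF chain_dist_le] .
  have "\<bar>mean i - mean j\<bar> \<le> adjacency_const * F * real m" using m(1) by (rule mean_relpow)
  also have "\<dots> \<le> adjacency_const * F * (K * log_dist Q i j)"
    using m(2) adjacency_const_pos F_pos by (intro mult_left_mono) auto
  finally show ?thesis .
qed

text \<open>The circumscribed ball lies in \<Omega> and has \<open>2 * s\<close> times the radius of
  the core. The resulting ratio of volumes enters twice, for the ball itself and for passing from
  its average to that over the core. The bound uses the volume of the core so that it can be summed
  over cubes.\<close>

lemma cube_oscillation_le:
  "(\<integral>\<^sup>+y\<in>q j. ennreal \<bar>f y - mean j\<bar> \<partial>lebesgue) \<le> ennreal (2 * (4 * s\<^sup>2) ^ CARD('n) * F) * emeasure lebesgue (core j)"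
proof -
  define r where "r = s / 2 * l j"
  define B where "B = cball (c j) r"
  let ?A = "(2 * s) ^ CARD('n)"
  have r: "0 < r" using s_ge by (simp add: r_def)
  have "r < s * l j" unfolding r_def using s_ge by (intro mult_strict_right_mono) auto
  then have sub: "B \<subseteq> \<Omega>" unfolding B_def using centre_in_cube by (intro cball_subset)
  have qB: "q j \<subseteq> B" using dist_c_le by (auto simp: B_def r_def dist_commute)
  have eB: "emeasure lebesgue B = ennreal (vol CARD('n) r)"
    unfolding B_def using r by (intro emeasure_lebesgue_cball) auto
  have intB: "set_integrable lebesgue B f" using sub by (intro f_integrable) (auto simp: B_def)
  have vr: "vol CARD('n) r = ?A * vol CARD('n) (l j / 4)"
    by (subst vol_mult[symmetric]) (simp add: r_def)
  have m: "\<bar>mean j - average B f\<bar> \<le> F * ?A"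
    unfolding B_def
  proof (rule mean_dist_cball)
    show "core j \<subseteq> cball (c j) r" using core_subset(1)[of j] qB unfolding B_def by blast
    show "r \<le> 2 * s * (l j / 4)" by (simp add: r_def)
  qed (use sub r in \<open>auto simp: B_def\<close>)
  have "1 \<le> ?A" using s_ge by (intro one_le_power) auto
  have "(\<integral>\<^sup>+y\<in>q j. ennreal \<bar>f y - mean j\<bar> \<partial>lebesgue) \<le> (\<integral>\<^sup>+y\<in>B. ennreal \<bar>f y - mean j\<bar> \<partial>lebesgue)"
    using qB by (intro nn_set_integral_set_mono) auto
  also have "\<dots> \<le> (\<integral>\<^sup>+y\<in>B. ennreal \<bar>f y - average B f\<bar> \<partial>lebesgue) + ennreal (\<bar>average B f - mean j\<bar> * vol CARD('n) r)"
    by (rule nn_integral_dist_shift[OF set_integrable_imp_measurable[OF intB] _ eB]) (simp add: B_def)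
  also have "\<dots> \<le> ennreal (F * vol CARD('n) r) + ennreal ((F * ?A) * vol CARD('n) r)"
    using oscillation_le[OF r] sub m r unfolding B_def
    by (intro add_mono ennreal_leI mult_right_mono) (auto simp: vol_nonneg abs_minus_commute)
  also have "\<dots> = ennreal ((F + F * ?A) * vol CARD('n) r)"
    using F_pos r s_ge by (simp add: vol_nonneg distrib_right flip: ennreal_plus)
  also have "\<dots> \<le> ennreal ((F * ?A + F * ?A) * vol CARD('n) r)"
    using \<open>1 \<le> ?A\<close> F_pos r by (intro ennreal_leI mult_right_mono add_mono) (auto simp: vol_nonneg)
  also have "(F * ?A + F * ?A) * vol CARD('n) r = (2 * (?A * ?A) * F) * vol CARD('n) (l j / 4)"
    unfolding vr by (simp add: algebra_simps)
  also have "?A * ?A = (4 * s\<^sup>2) ^ CARD('n)"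
  proof -
    have "4 * s\<^sup>2 = (2 * s) * (2 * s)" by (simp add: power2_eq_square)
    then show ?thesis by (simp only: power_mult_distrib[of "2 * s" "2 * s"])
  qed
  finally show ?thesis
    using F_pos by (simp add: emeasure_core ennreal_mult' del: emeasure_completion)
qed

text \<open>The core lies in a ball of radius \<open>r0\<close>, so the local part of the norm
  controls the integral; the lower bound on the side controls the volume it is divided by.\<close>

lemma abs_mean_le:
  assumes "a \<le> l i / 4" "l i / 4 \<le> r0" "0 < a"
  shows "\<bar>mean i\<bar> \<le> F / vol CARD('n) a"
proof -
  have "\<bar>mean i - 0\<bar> \<le> F / vol CARD('n) (l i / 4)"
    unfolding mean_def
  proof (rule average_dist_le[OF f_integrable subset_refl _ emeasure_core])
    have "core i \<subseteq> cball (c i) r0 \<inter> \<Omega>" using core_subset assms by auto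
    then have "(\<integral>\<^sup>+y\<in>core i. ennreal \<bar>f y - 0\<bar> \<partial>lebesgue) \<le> (\<integral>\<^sup>+y\<in>cball (c i) r0 \<inter> \<Omega>. ennreal \<bar>f y\<bar> \<partial>lebesgue)"
      unfolding diff_zero by (intro nn_set_integral_set_mono) auto
    also note local_le
    finally show "(\<integral>\<^sup>+y\<in>core i. ennreal \<bar>f y - 0\<bar> \<partial>lebesgue) \<le> ennreal F" .
  qed (use F_pos core_subset in \<open>auto simp: vol_pos\<close>)
  also have "\<dots> \<le> F / vol CARD('n) a"
    using assms F_pos by (intro divide_left_mono vol_mono mult_pos_pos vol_pos) auto
  finally show ?thesis by simp
qed

end

section \<open>Extension by reflection\<close>

lemma ennreal_plus_le: "0 \<le> b \<Longrightarrow> ennreal (a + b) \<le> ennreal a + ennreal b"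
  by (cases "0 \<le> a") (auto simp: ennreal_neg intro: ennreal_leI)

lemma borel_measurable_infdist [measurable]: "(\<lambda>x. infdist x A) \<in> borel_measurable borel"
  by (intro borel_measurable_continuous_onI continuous_on_infdist continuous_on_id)

context porous_whitney
begin

lemma near_point:
  assumes "infdist x \<Omega> < \<delta>"
  obtains z j where "z \<in> q j" "dist z x < \<delta>"
proof -
  have "\<Omega> \<noteq> {}" using Union_q centre_in_cube by blast
  then obtain z where z: "z \<in> \<Omega>" "dist x z < \<delta>"
    using assms infdist_notempty[of \<Omega> x] cINF_less_iff[of \<Omega> "dist x"] by auto
  then show thesis using that Union_q by (metis UN_E dist_commute)
qed

lemma side_le_dist':
  assumes "x \<in> q j" "y \<notin> \<Omega>"
  shows "l j \<le> dist x y"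
proof -
  have "1 * l j \<le> s * l j" using s_ge by (intro mult_right_mono) (auto simp: less_imp_le)
  also have "\<dots> \<le> dist x y" using assms by (rule side_le_dist)
  finally show ?thesis by simp
qed

text \<open>If the cube \<open>j\<close> is small, \<open>cube_at_scale_centre\<close> supplies a
  larger one. If it is large, the point \<open>w\<close> of the complement within
  \<open>3 * r\<close> limits its side to \<open>3 * r\<close>, and it serves itself.\<close>

lemma base_cube:
  assumes z: "z \<in> q j" "dist z x \<le> 2 * r" and w: "w \<notin> \<Omega>" "dist x w \<le> r" and r: "0 < r" "r \<le> t0"
  obtains i where "r / 2 \<le> l i" "l i \<le> 4 * r" "dist x (c i) \<le> (L + 5) * r"
proof (cases "l j \<le> r")
  case True
  from cube_at_scale_centre[OF True r(2) z(1)] obtain i where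
    i: "r / 2 \<le> l i" "l i \<le> 4 * r" "dist z (c i) \<le> L * r" .
  have "dist x (c i) \<le> (L + 5) * r"
    using i(3) z(2) r dist_triangle[of x "c i" z] by (simp add: dist_commute algebra_simps)
  with i that show thesis by blast
next
  case False
  have d: "dist z w \<le> 3 * r" using z w dist_triangle[of z w x] by simp
  have "s * l j \<le> 3 * r" using side_le_dist[OF z(1) w(1)] d by linarith
  then have "dist z (c j) \<le> 3 * r" using dist_c_le[OF z(1)] r by simp
  then have "dist x (c j) \<le> 5 * r" using z(2) dist_triangle[of x "c j" z] by (simp add: dist_commute)
  also have "\<dots> \<le> (L + 5) * r" using L_ge r by (intro mult_right_mono) auto
  finally have "dist x (c j) \<le> (L + 5) * r" .
  moreover have "l j \<le> 3 * r" using side_le_dist'[OF z(1) w(1)] d by linarith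
  ultimately show thesis using that[of j] False r by linarith
qed

section \<open>Reflected cubes and the extension operator\<close>

definition is_reflection :: "real ^ 'n \<Rightarrow> nat \<Rightarrow> bool" where
  "is_reflection x i \<longleftrightarrow> infdist x \<Omega> / 2 \<le> l i \<and> l i \<le> 4 * infdist x \<Omega> \<and> dist x (c i) \<le> (L + 5) * infdist x \<Omega>"

text \<open>
  Choosing the least index makes the reflection measurable without a decomposition of the
  complement.
\<close>

definition reflection :: "real ^ 'n \<Rightarrow> nat" where
  "reflection x = (LEAST i. is_reflection x i)"

lemma is_reflection_reflection:
  assumes "x \<notin> \<Omega>" "0 < infdist x \<Omega>" "infdist x \<Omega> \<le> t0"
  shows "is_reflection x (reflection x)"
proof -
  obtain z j where zj: "z \<in> q j" "dist z x < 2 * infdist x \<Omega>"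
    using near_point[of x "2 * infdist x \<Omega>"] assms by auto
  \<comment> \<open>The point \<open>x\<close> itself is taken as the point \<open>w\<close> of the
    complement.\<close>
  obtain i where "is_reflection x i"
    using base_cube[OF zj(1) less_imp_le[OF zj(2)] assms(1) _ assms(2,3)] assms(2)
    unfolding is_reflection_def by auto
  then show ?thesis unfolding reflection_def by (rule LeastI)
qed

lemma reflection_measurable: "reflection \<in> measurable borel (count_space UNIV)"
  unfolding reflection_def is_reflection_def
  by (intro measurable_Least) measurable

text \<open>The boundary gets the value 0 by convention; the pointwise bound there is
  infinite.\<close>

definition extension :: "real \<Rightarrow> (real ^ 'n \<Rightarrow> real) \<Rightarrow> real ^ 'n \<Rightarrow> real" where
  "extension \<tau> f x =
    (if x \<in> \<Omega> then f x
     else if 0 < infdist x \<Omega> \<and> infdist x \<Omega> < \<tau> then average (core (reflection x)) f else 0)"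

lemma open_domain: "open \<Omega>"
  unfolding open_contains_ball
proof
  fix x assume "x \<in> \<Omega>"
  then obtain j where j: "x \<in> q j" using Union_q by blast
  have "cball x (s * l j / 2) \<subseteq> \<Omega>" using s_ge j by (intro cball_subset) (auto simp: mult_pos_pos)
  then have "ball x (s * l j / 2) \<subseteq> \<Omega>" using ball_subset_cball by blast
  moreover have "0 < s * l j / 2" using s_ge by simp
  ultimately show "\<exists>e>0. ball x e \<subseteq> \<Omega>" by blast
qed

text \<open>Inside \<Omega> measurability is glued from countably many cubes; outside, the function
  factors through the measurable index \<open>reflection\<close>.\<close>

lemma extension_measurable:
  assumes "\<And>S. compact S \<Longrightarrow> S \<subseteq> \<Omega> \<Longrightarrow> set_integrable lebesgue S f"
  shows "extension \<tau> f \<in> borel_measurable lebesgue"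
proof -
  have qm: "(\<lambda>x. indicator (q j) x * f x) \<in> borel_measurable lebesgue" for j
  proof -
    have "compact (q j)" by (simp add: cube_def compact_cbox)
    then have "set_integrable lebesgue (q j) f" using assms Union_q by blast
    then show ?thesis by (simp add: set_integrable_def)
  qed
  have "f -` B \<inter> \<Omega> \<in> sets lebesgue" if B: "B \<in> sets borel" for B
  proof -
    have "f -` B \<inter> \<Omega> = (\<Union>j. ((\<lambda>x. indicator (q j) x * f x) -` B \<inter> space lebesgue) \<inter> q j)"
      using Union_q by (auto split: split_indicator)
    also have "\<dots> \<in> sets lebesgue"
      using measurable_sets[OF qm B] by (intro sets.countable_UN) (auto simp: cube_def)
    finally show ?thesis .
  qed
  then have 1: "f \<in> borel_measurable (restrict_space lebesgue \<Omega>)"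
    using open_domain by (intro measurableI) (auto simp: sets_restrict_space_iff space_restrict_space)
  have 2: "(\<lambda>x. if 0 < infdist x \<Omega> \<and> infdist x \<Omega> < \<tau> then average (core (reflection x)) f else 0) \<in> borel_measurable borel"
  proof -
    have "(\<lambda>x. average (core (reflection x)) f) \<in> borel_measurable borel"
      using measurable_compose[OF reflection_measurable, of "\<lambda>i. average (core i) f" borel] by simp
    then show ?thesis by measurable
  qed
  then have 3: "(\<lambda>x. if 0 < infdist x \<Omega> \<and> infdist x \<Omega> < \<tau> then average (core (reflection x)) f else 0) \<in> borel_measurable lebesgue"
    by (intro measurable_completion) simp
  have 4: "(\<lambda>x. if x \<in> \<Omega> then f x else 0) \<in> borel_measurable lebesgue"
    using 1 open_domain by (subst borel_measurable_if) auto
  have "{x \<in> space lebesgue. x \<in> \<Omega>} \<in> sets lebesgue" using open_domain by simp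
  from measurable_If[OF 4 3 this] show ?thesis
    by (rule measurable_cong[THEN iffD1, rotated]) (simp add: extension_def)
qed

end

text \<open>\<tau> \<le> \<open>t0\<close> makes reflected cubes exist; \<tau> \<le>
  \<open>r0\<close> keeps their cores, of radius at most the distance to \<Omega>, within reach of
  the local part of the norm.\<close>

locale bmo_extension = bmo_on_whitney \<Omega> Q s K N L t0 f F r0
  for \<Omega> :: "(real ^ 'n::finite) set" and Q :: "nat \<Rightarrow> 'n dyadic" and s K N L t0 f F r0 +
  fixes \<tau> :: real
  assumes \<tau>: "0 < \<tau>" "\<tau> \<le> t0" "\<tau> \<le> r0"
begin

abbreviation h :: "real ^ 'n \<Rightarrow> real" where "h \<equiv> extension \<tau> f"

lemma h_measurable [measurable]: "h \<in> borel_measurable lebesgue"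
  using f_integrable by (rule extension_measurable)

lemma h_inside: "x \<in> \<Omega> \<Longrightarrow> h x = f x"
  by (simp add: extension_def)

lemma h_outside:
  assumes "x \<notin> \<Omega>" "0 < infdist x \<Omega>" "infdist x \<Omega> < \<tau>"
  shows "h x = mean (reflection x)" "infdist x \<Omega> / 2 \<le> l (reflection x)"
    "l (reflection x) \<le> 4 * infdist x \<Omega>" "dist x (c (reflection x)) \<le> (L + 5) * infdist x \<Omega>"
  using is_reflection_reflection[of x] assms \<tau> by (auto simp: extension_def mean_def is_reflection_def)

lemma abs_h_far_le:
  assumes "x \<notin> \<Omega>" "\<tau> / 10 \<le> infdist x \<Omega>"
  shows "\<bar>h x\<bar> \<le> F / vol CARD('n) (\<tau> / 80)"
proof (cases "infdist x \<Omega> < \<tau>")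
  case True
  have "0 < infdist x \<Omega>" using assms \<tau> by linarith
  note * = h_outside[OF assms(1) this True]
  \<comment> \<open>A cube reflected from distance at least \<tau> / 10 has side at least \<tau> /
    20, hence a core of radius at least \<tau> / 80.\<close>
  show ?thesis
    unfolding *(1) by (rule abs_mean_le) (use * assms True \<tau> in linarith)+
next
  case False
  then show ?thesis using assms F_pos \<tau> by (simp add: extension_def vol_nonneg)
qed

section \<open>Pointwise bounds near the boundary\<close>

definition chain_const :: real where "chain_const = adjacency_const * F * K"

lemma chain_const_pos: "0 < chain_const"
  using adjacency_const_pos F_pos K_pos by (simp add: chain_const_def)

text \<open>The constants are dictated by \<open>h_dist_mean_le\<close>. There a reflected point has
  distance less than \<open>3 * r\<close> from \<Omega>, so its cube has side at most
  \<open>12 * r\<close> and centre within \<open>3 * (L + 5) * r\<close> of it; the centre of cube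
  \<open>i\<close> adds \<open>(L + 6) * r\<close>. The extra 4 bounds ln 4, lost by
  reflection.\<close>

lemma mean_diff_shadow_le:
  assumes j: "l j \<le> 12 * r" and i: "r / 2 \<le> l i" "l i \<le> 4 * r" and r: "0 < r"
    and d: "dist (c j) (c i) \<le> (4 * L + 22) * r"
    and ln: "ennreal (ln (r / l j)) \<le> 4 * shadow_count x0 r x + 4"
  shows "ennreal \<bar>mean j - mean i\<bar> \<le> ennreal chain_const * (4 * shadow_count x0 r x + ennreal (8 * L + 60))"
proof -
  have "\<bar>mean j - mean i\<bar> \<le> chain_const * (ln (r / l j) + (8 * L + 56))"
  proof -
    have "log_dist Q j i \<le> ln (r / l j) + 12 + 2 * (4 * L + 22)"
      by (rule log_dist_le_ln[OF j i r d])
    then have "chain_const * log_dist Q j i \<le> chain_const * (ln (r / l j) + (8 * L + 56))"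
      using chain_const_pos by (intro mult_left_mono) auto
    then show ?thesis using mean_diff_le[of j i] by (simp add: chain_const_def mult_ac)
  qed
  then have "ennreal \<bar>mean j - mean i\<bar> \<le> ennreal (chain_const * (ln (r / l j) + (8 * L + 56)))"
    by (rule ennreal_leI)
  also have "\<dots> = ennreal chain_const * ennreal (ln (r / l j) + (8 * L + 56))"
    using chain_const_pos by (intro ennreal_mult') auto
  also have "ennreal (ln (r / l j) + (8 * L + 56)) \<le> ennreal (ln (r / l j)) + ennreal (8 * L + 56)"
    using L_ge by (intro ennreal_plus_le) auto
  also have "\<dots> \<le> 4 * shadow_count x0 r x + 4 + ennreal (8 * L + 56)"
    using ln by (rule add_right_mono)
  also have "\<dots> = 4 * shadow_count x0 r x + (ennreal 4 + ennreal (8 * L + 56))"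
    by (simp add: add.assoc)
  also have "ennreal 4 + ennreal (8 * L + 56) = ennreal (8 * L + 60)"
    using L_ge by (subst ennreal_plus[symmetric]) auto
  finally show ?thesis by (simp add: mult_left_mono)
qed

text \<open>Points of \<Omega> come within every \<delta> of \<open>x\<close>, so
  \<open>ln_le_shadow_count\<close> bounds the count from below by arbitrarily large logarithms;
  \<delta> is chosen to make the logarithm equal to \<open>m\<close>.\<close>

lemma shadow_count_infinite:
  assumes "x \<notin> \<Omega>" "infdist x \<Omega> = 0" "dist x x0 \<le> r" "0 < r" "r \<le> t0"
  shows "4 * shadow_count x0 r x = \<infinity>"
proof (rule ccontr)
  assume "4 * shadow_count x0 r x \<noteq> \<infinity>"
  then obtain m :: nat where m: "4 * shadow_count x0 r x < of_nat m"
    using ennreal_Ex_less_of_nat[of "4 * shadow_count x0 r x"] by (auto simp: less_top)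
  define \<delta> where "\<delta> = r * exp (- real m)"
  have "0 < \<delta>" using assms by (simp add: \<delta>_def)
  then obtain z j where z: "z \<in> q j" "dist z x < \<delta>" using near_point[of x \<delta>] assms by auto
  have "l j \<le> \<delta>" using side_le_dist'[OF z(1) assms(1)] z(2) by linarith
  then have "ennreal (ln (r / \<delta>)) \<le> 4 * shadow_count x0 r x"
    using z assms by (intro ln_le_shadow_count[of z j]) auto
  moreover have "r / \<delta> = exp (real m)" using assms by (simp add: \<delta>_def exp_minus field_simps)
  then have "ln (r / \<delta>) = real m" by simp
  ultimately show False using m by (simp add: ennreal_of_nat_eq_real_of_nat)
qed

text \<open>In \<Omega> the deviation splits at the mean over the cube of \<open>x\<close>: the sum
  carries the oscillation inside that cube, the second term the chain from there to
  \<open>i\<close>. Outside, the value is already a mean and only the chain remains. On the boundary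
  the right side is infinite.\<close>

lemma h_dist_mean_le:
  assumes x: "dist x x0 \<le> r" and w: "w \<notin> \<Omega>" "dist x0 w \<le> r" and d0: "infdist x0 \<Omega> < 2 * r"
    and r: "0 < r" "3 * r < \<tau>"
    and i: "r / 2 \<le> l i" "l i \<le> 4 * r" "dist x0 (c i) \<le> (L + 5) * r"
  shows "ennreal \<bar>h x - mean i\<bar> \<le>
    (\<Sum>j. if q j \<inter> cball x0 r \<noteq> {} then ennreal \<bar>f x - mean j\<bar> * indicator (q j) x else 0)
    + ennreal chain_const * (4 * shadow_count x0 r x + ennreal (8 * L + 60))" (is "_ \<le> ?S + ?T")
proof -
  have rt: "r \<le> t0" using r \<tau> by linarith
  have xi: "dist x (c i) \<le> (L + 6) * r"
    using i(3) x dist_triangle[of x "c i" x0] by (simp add: algebra_simps)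
  consider "x \<in> \<Omega>" | "x \<notin> \<Omega>" "infdist x \<Omega> = 0" | "x \<notin> \<Omega>" "0 < infdist x \<Omega>"
    using infdist_nonneg[of x \<Omega>] by linarith
  then show ?thesis
  proof cases
    case 1
    then obtain j where j: "x \<in> q j" using Union_q by blast
    have xw: "dist x w \<le> 2 * r" using x w dist_triangle[of x w x0] by simp
    have lj: "l j \<le> 2 * r" using side_le_dist'[OF j w(1)] xw by linarith
    have "dist x (c j) \<le> r" using dist_c_le[OF j] side_le_dist[OF j w(1)] xw by simp
    then have "dist (c j) (c i) \<le> (L + 7) * r"
      using dist_triangle[of "c j" "c i" x] xi by (simp add: dist_commute algebra_simps)
    also have "\<dots> \<le> (4 * L + 22) * r" using L_ge r by (intro mult_right_mono) auto
    finally have "dist (c j) (c i) \<le> (4 * L + 22) * r" .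
    moreover have "ennreal (ln (r / l j)) \<le> 4 * shadow_count x0 r x"
      using j x rt by (intro ln_le_shadow_count[of x j]) (auto simp: less_imp_le)
    then have "ennreal (ln (r / l j)) \<le> 4 * shadow_count x0 r x + 4"
      by (rule order_trans) (rule add_increasing2, simp_all)
    ultimately have "ennreal \<bar>mean j - mean i\<bar> \<le> ?T"
      using lj i r by (intro mean_diff_shadow_le) auto
    moreover have "ennreal \<bar>f x - mean j\<bar> \<le> ?S"
    proof -
      have "x \<in> q j \<inter> cball x0 r" using j x by (simp add: dist_commute)
      then have "ennreal \<bar>f x - mean j\<bar> = (\<Sum>k\<in>{j}. if q k \<inter> cball x0 r \<noteq> {} then ennreal \<bar>f x - mean k\<bar> * indicator (q k) x else 0)"
        using j by auto
      also have "\<dots> \<le> ?S" by (rule sum_le_suminf) auto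
      finally show ?thesis .
    qed
    moreover have "ennreal \<bar>h x - mean i\<bar> \<le> ennreal \<bar>f x - mean j\<bar> + ennreal \<bar>mean j - mean i\<bar>"
      using 1 by (simp add: h_inside ennreal_leI flip: ennreal_plus)
    ultimately show ?thesis by (meson add_mono order_trans)
  next
    case 2
    have "?T = \<infinity>"
      using shadow_count_infinite[OF 2 x r(1) rt] chain_const_pos by (simp add: ennreal_mult_eq_top_iff)
    then show ?thesis by simp
  next
    case 3
    define d where "d = infdist x \<Omega>"
    define j where "j = reflection x"
    have d3: "d < 3 * r" using infdist_triangle[of x \<Omega> x0] x d0 by (simp add: d_def)
    have dpos: "0 < d" using 3 by (simp add: d_def)
    have "d < \<tau>" using d3 r by linarith
    note h = h_outside[OF 3, folded d_def, OF this, folded j_def]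
    have "dist x (c j) \<le> (L + 5) * (3 * r)"
      using h(4) d3 L_ge by (rule_tac order_trans[OF _ mult_left_mono[of d "3 * r"]]) auto
    then have "dist (c j) (c i) \<le> (4 * L + 22) * r"
      using dist_triangle[of "c j" "c i" x] xi r by (simp add: dist_commute algebra_simps)
    moreover have "ennreal (ln (r / l j)) \<le> 4 * shadow_count x0 r x + 4"
    proof -
      \<comment> \<open>A cube that comes within \<open>2 * d\<close> of \<open>x\<close> has side
        at most \<open>2 * d\<close>, since \<open>x\<close> is outside \<Omega>; so
        \<open>2 * d\<close> can be the \<delta> of \<open>ln_le_shadow_count\<close>.\<close>
      obtain z k where z: "z \<in> q k" "dist z x < 2 * d"
        using near_point[of x "2 * d"] dpos by (auto simp: d_def)
      have "l k \<le> 2 * d" using side_le_dist'[OF z(1) 3(1)] z(2) by linarith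
      then have *: "ennreal (ln (r / (2 * d))) \<le> 4 * shadow_count x0 r x"
        using z x rt by (intro ln_le_shadow_count[of z k]) auto
      have "r / l j \<le> r / (d / 2)" using h(2) dpos r by (intro divide_left_mono) auto
      also have "\<dots> = 4 * (r / (2 * d))" by simp
      finally have "ln (r / l j) \<le> ln (4 * (r / (2 * d)))" using r dpos by simp
      also have "\<dots> = ln (r / (2 * d)) + ln 4" using r dpos by (subst ln_mult) auto
      also have "ln 4 \<le> 4 * real 1" by (rule ln_le_four_mult) auto
      finally have "ennreal (ln (r / l j)) \<le> ennreal (ln (r / (2 * d)) + 4)" by (intro ennreal_leI) simp
      also have "\<dots> \<le> ennreal (ln (r / (2 * d))) + ennreal 4" by (rule ennreal_plus_le) simp
      also have "\<dots> \<le> 4 * shadow_count x0 r x + ennreal 4" using * by (rule add_right_mono)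
      finally show ?thesis by simp
    qed
    ultimately have "ennreal \<bar>mean j - mean i\<bar> \<le> ?T"
      using h(3) d3 i r by (intro mean_diff_shadow_le) auto
    then show ?thesis using h(1) by (simp add: add_increasing)
  qed
qed

end

section \<open>Oscillation of the extension\<close>

text \<open>Balls of radius \<rho> / 2 about the points are disjoint and lie in the ball of radius
  \<open>3 * r / 2\<close>.\<close>

lemma card_separated_le:
  fixes S :: "(real ^ 'n::finite) set"
  assumes S: "finite S" "S \<subseteq> cball x r" "\<And>a b. a \<in> S \<Longrightarrow> b \<in> S \<Longrightarrow> a \<noteq> b \<Longrightarrow> \<rho> < dist a b"
    and \<rho>: "0 < \<rho>" "\<rho> \<le> r"
  shows "real (card S) \<le> 3 ^ CARD('n) * vol CARD('n) r / vol CARD('n) \<rho>"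
proof -
  have disj: "disjoint_family_on (\<lambda>a. cball a (\<rho> / 2)) S"
    unfolding disjoint_family_on_def
  proof (intro ballI impI)
    fix a b assume ab: "a \<in> S" "b \<in> S" "a \<noteq> b"
    show "cball a (\<rho> / 2) \<inter> cball b (\<rho> / 2) = {}"
    proof (rule ccontr)
      assume "cball a (\<rho> / 2) \<inter> cball b (\<rho> / 2) \<noteq> {}"
      then obtain y where "dist a y \<le> \<rho> / 2" "dist b y \<le> \<rho> / 2" by auto
      then have "dist a b \<le> \<rho>" using dist_triangle2[of a b y] by simp
      then show False using S(3)[OF ab] by simp
    qed
  qed
  have "of_nat (card S) * ennreal (vol CARD('n) (\<rho> / 2)) = (\<Sum>a\<in>S. emeasure lebesgue (cball a (\<rho> / 2)))"
    using \<rho> by (simp add: emeasure_lebesgue_cball del: emeasure_completion)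
  also have "\<dots> = emeasure lebesgue (\<Union>a\<in>S. cball a (\<rho> / 2))"
    using S(1) disj by (intro sum_emeasure) auto
  also have "\<dots> \<le> emeasure lebesgue (cball x (3 * r / 2))"
  proof (intro emeasure_mono UN_least subsetI)
    fix a y assume "a \<in> S" "y \<in> cball a (\<rho> / 2)"
    then show "y \<in> cball x (3 * r / 2)"
      using S(2) \<rho> dist_triangle[of x y a] by fastforce
  qed simp
  also have "\<dots> = ennreal (vol CARD('n) (3 * r / 2))"
    using \<rho> by (intro emeasure_lebesgue_cball) auto
  finally have "real (card S) * vol CARD('n) (\<rho> / 2) \<le> vol CARD('n) (3 * r / 2)"
    using \<rho> by (simp add: ennreal_of_nat_eq_real_of_nat vol_nonneg flip: ennreal_mult')
  also have "vol CARD('n) (3 * r / 2) = 3 ^ CARD('n) * ((1 / 2) ^ CARD('n) * vol CARD('n) r)"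
    by (simp only: vol_mult[symmetric]) simp
  also have "vol CARD('n) (\<rho> / 2) = (1 / 2) ^ CARD('n) * vol CARD('n) \<rho>"
    by (simp only: vol_mult[symmetric]) simp
  finally have "(1 / 2) ^ CARD('n) * (real (card S) * vol CARD('n) \<rho>) \<le> (1 / 2) ^ CARD('n) * (3 ^ CARD('n) * vol CARD('n) r)"
    by (simp only: mult_ac)
  then have "real (card S) * vol CARD('n) \<rho> \<le> 3 ^ CARD('n) * vol CARD('n) r"
    by (rule mult_left_le_imp_le) simp
  then show ?thesis using vol_pos[OF \<rho>(1)] by (simp add: pos_le_divide_eq)
qed

text \<open>\<open>card_separated_le\<close> yields a \<rho>-separated subset of the ball with the
  most points; by maximality the balls of radius \<rho> about them cover.\<close>

lemma nn_integral_cball_le_of_small: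
  fixes g :: "real ^ 'n::finite \<Rightarrow> ennreal"
  assumes g: "g \<in> borel_measurable lebesgue"
    and small: "\<And>x. (\<integral>\<^sup>+y\<in>cball x \<rho>. g y \<partial>lebesgue) \<le> ennreal M"
    and \<rho>: "0 < \<rho>" "\<rho> \<le> r" and M: "0 \<le> M"
  shows "(\<integral>\<^sup>+y\<in>cball x r. g y \<partial>lebesgue) \<le> ennreal (3 ^ CARD('n) * vol CARD('n) r / vol CARD('n) \<rho> * M)"
proof -
  let ?P = "\<lambda>S. finite S \<and> S \<subseteq> cball x r \<and> (\<forall>a\<in>S. \<forall>b\<in>S. a \<noteq> b \<longrightarrow> \<rho> < dist a b)"
  let ?N = "3 ^ CARD('n) * vol CARD('n) r / vol CARD('n) \<rho>"
  have bound: "real (card S) \<le> ?N" if "?P S" for S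
    using that \<rho> by (intro card_separated_le) auto
  have "card S \<le> nat \<lfloor>?N\<rfloor>" if "?P S" for S
    using bound[OF that] by (simp add: le_nat_floor)
  then have "\<exists>S. ?P S \<and> (\<forall>T. ?P T \<longrightarrow> card T \<le> card S)"
    by (intro ex_has_greatest_nat[of ?P "{}" card "Suc (nat \<lfloor>?N\<rfloor>)"]) (auto simp: less_Suc_eq_le)
  then obtain S where S: "?P S" "\<And>T. ?P T \<Longrightarrow> card T \<le> card S"
    by blast
  have cover: "\<exists>a\<in>S. y \<in> cball a \<rho>" if y: "y \<in> cball x r" for y
  proof (rule ccontr)
    assume *: "\<not> (\<exists>a\<in>S. y \<in> cball a \<rho>)"
    then have "y \<notin> S" using \<rho> by auto
    moreover have "?P (insert y S)" using S(1) y * by (auto simp: dist_commute not_le)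
    ultimately show False using S(2)[of "insert y S"] S(1) by simp
  qed
  have "(\<integral>\<^sup>+y\<in>cball x r. g y \<partial>lebesgue) \<le> (\<integral>\<^sup>+y. (\<Sum>a\<in>S. g y * indicator (cball a \<rho>) y) \<partial>lebesgue)"
  proof (intro nn_integral_mono)
    fix y
    show "g y * indicator (cball x r) y \<le> (\<Sum>a\<in>S. g y * indicator (cball a \<rho>) y)"
    proof (cases "y \<in> cball x r")
      case True
      then obtain a where a: "a \<in> S" "y \<in> cball a \<rho>" using cover by blast
      then have "g y * indicator (cball x r) y = (\<Sum>a\<in>{a}. g y * indicator (cball a \<rho>) y)" using True by simp
      also have "\<dots> \<le> (\<Sum>a\<in>S. g y * indicator (cball a \<rho>) y)"
        using a S(1) by (intro sum_mono2) auto
      finally show ?thesis .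
    qed simp
  qed
  also have "\<dots> = (\<Sum>a\<in>S. \<integral>\<^sup>+y\<in>cball a \<rho>. g y \<partial>lebesgue)"
    by (intro nn_integral_sum borel_measurable_times_ennreal g borel_measurable_indicator) simp
  also have "\<dots> \<le> (\<Sum>a\<in>S. ennreal M)"
    by (intro sum_mono small)
  also have "\<dots> = ennreal (real (card S) * M)"
    using M by (simp add: ennreal_of_nat_eq_real_of_nat ennreal_mult)
  also have "\<dots> \<le> ennreal (?N * M)"
    using bound[OF S(1)] M by (intro ennreal_leI mult_right_mono) auto
  finally show ?thesis .
qed

section \<open>Balls near the boundary\<close>

context bmo_extension
begin

text \<open>The three terms come from the oscillation on single cubes, the constant part of the
  chain bound, and the integral of \<open>shadow_count\<close>.\<close>

definition near_const :: real where
  "near_const = 2 * (4 * s\<^sup>2) ^ CARD('n) * 3 ^ CARD('n) + adjacency_const * K * (8 * L + 60) + 4 * adjacency_const * K * (8 * (L + 1)) ^ CARD('n) * (L + 3) ^ CARD('n)"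

lemma near_const_nonneg: "0 \<le> near_const"
  using s_ge adjacency_const_pos K_pos L_ge by (simp add: near_const_def)

lemma near_boundary_le:
  assumes w: "w \<notin> \<Omega>" "dist x0 w \<le> r" and d0: "infdist x0 \<Omega> < 2 * r" and r: "0 < r" "3 * r < \<tau>"
  obtains i where "r / 2 \<le> l i" "l i \<le> 4 * r"
    "(\<integral>\<^sup>+y\<in>cball x0 r. ennreal \<bar>h y - mean i\<bar> \<partial>lebesgue) \<le> ennreal (near_const * F * vol CARD('n) r)"
proof -
  obtain z j where zj: "z \<in> q j" "dist z x0 < 2 * r" using near_point[OF d0] .
  have rt: "r \<le> t0" using r \<tau> by linarith
  obtain i where i: "r / 2 \<le> l i" "l i \<le> 4 * r" "dist x0 (c i) \<le> (L + 5) * r"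
    using base_cube[OF zj(1) less_imp_le[OF zj(2)] w r(1) rt] .
  let ?P = "\<lambda>j. q j \<inter> cball x0 r \<noteq> {}"
  let ?S = "\<lambda>y j. if ?P j then ennreal \<bar>f y - mean j\<bar> * indicator (q j) y else 0"
  let ?Cq = "2 * (4 * s\<^sup>2) ^ CARD('n) * F"
  have qm: "(\<lambda>y. ennreal \<bar>f y - mean j\<bar> * indicator (q j) y) \<in> borel_measurable lebesgue" for j
  proof (rule measurable_abs_diff_indicator[OF set_integrable_imp_measurable])
    show "set_integrable lebesgue (q j) f"
      using Union_q by (intro f_integrable) (auto simp: cube_def compact_cbox)
  qed (simp add: cube_def)
  \<comment> \<open>A cube meeting the ball has diameter at most the distance from a common point to
    \<open>w\<close>, which is at most \<open>2 * r\<close>; hence \<open>3 * r\<close>.\<close>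
  have core_sub: "core j \<subseteq> cball x0 (3 * r)" if P: "?P j" for j
  proof
    fix u assume u: "u \<in> core j"
    obtain y where y: "y \<in> q j" "dist x0 y \<le> r" using P by auto
    have "dist y u \<le> s * l j" using y core_subset(1)[of j] u unfolding s_def by (intro dist_cube_le) auto
    also have "\<dots> \<le> dist y w" using y w by (intro side_le_dist)
    also have "\<dots> \<le> 2 * r" using dist_triangle[of y w x0] y w by (simp add: dist_commute)
    finally show "u \<in> cball x0 (3 * r)" using y dist_triangle[of x0 u y] by simp
  qed
  have S: "(\<integral>\<^sup>+y. (\<Sum>j. ?S y j) \<partial>lebesgue) \<le> ennreal (?Cq * 3 ^ CARD('n) * vol CARD('n) r)"
  proof -
    have "(\<integral>\<^sup>+y. (\<Sum>j. ?S y j) \<partial>lebesgue) = (\<Sum>j. \<integral>\<^sup>+y. ?S y j \<partial>lebesgue)"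
      using qm by (intro nn_integral_suminf) auto
    also have "\<dots> \<le> (\<Sum>j. ennreal ?Cq * (if ?P j then emeasure lebesgue (core j) else 0))"
      using cube_oscillation_le by (intro suminf_le) (auto simp del: emeasure_completion)
    also have "\<dots> = ennreal ?Cq * (\<Sum>j. if ?P j then emeasure lebesgue (core j) else 0)"
      by (rule ennreal_suminf_cmult)
    also have "\<dots> \<le> ennreal ?Cq * emeasure lebesgue (cball x0 (3 * r))"
      using core_sub by (intro mult_left_mono suminf_emeasure_core_le) auto
    also have "\<dots> = ennreal ?Cq * ennreal (3 ^ CARD('n) * vol CARD('n) r)"
      using r by (simp add: emeasure_lebesgue_cball vol_mult del: emeasure_completion)
    also have "\<dots> = ennreal (?Cq * (3 ^ CARD('n) * vol CARD('n) r))"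
      using F_pos by (intro ennreal_mult'[symmetric]) auto
    finally show ?thesis by (simp only: mult.assoc)
  qed
  have "(\<integral>\<^sup>+y\<in>cball x0 r. ennreal \<bar>h y - mean i\<bar> \<partial>lebesgue)
      \<le> (\<integral>\<^sup>+y. (\<Sum>j. ?S y j) + (ennreal (4 * chain_const) * shadow_count x0 r y + ennreal (chain_const * (8 * L + 60)) * indicator (cball x0 r) y) \<partial>lebesgue)"
  proof (intro nn_integral_mono)
    fix y
    show "ennreal \<bar>h y - mean i\<bar> * indicator (cball x0 r) y
      \<le> (\<Sum>j. ?S y j) + (ennreal (4 * chain_const) * shadow_count x0 r y + ennreal (chain_const * (8 * L + 60)) * indicator (cball x0 r) y)"
    proof (cases "y \<in> cball x0 r")
      case True
      have "ennreal chain_const * (4 * shadow_count x0 r y + ennreal (8 * L + 60))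
        = ennreal (4 * chain_const) * shadow_count x0 r y + ennreal (chain_const * (8 * L + 60))"
        using chain_const_pos L_ge by (simp add: distrib_left ennreal_mult mult_ac)
      with h_dist_mean_le[OF _ w d0 r i, of y] True show ?thesis
        by (simp add: dist_commute)
    qed simp
  qed
  also have "\<dots> = (\<integral>\<^sup>+y. (\<Sum>j. ?S y j) \<partial>lebesgue) + (ennreal (4 * chain_const) * (\<integral>\<^sup>+y. shadow_count x0 r y \<partial>lebesgue)
      + ennreal (chain_const * (8 * L + 60)) * emeasure lebesgue (cball x0 r))"
  proof -
    have [measurable]: "(\<lambda>y. ?S y j) \<in> borel_measurable lebesgue" for j
      using qm by (cases "?P j") auto
    have [measurable]: "cball x0 r \<in> sets lebesgue" by simp
    show ?thesis
      by (subst nn_integral_add, measurable, subst nn_integral_add, measurable,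
          subst nn_integral_cmult, measurable, subst nn_integral_cmult_indicator, measurable)
  qed
  also have "\<dots> \<le> ennreal (?Cq * 3 ^ CARD('n) * vol CARD('n) r)
      + (ennreal (4 * chain_const) * ennreal ((8 * (L + 1)) ^ CARD('n) * vol CARD('n) ((L + 3) * r))
      + ennreal (chain_const * (8 * L + 60)) * ennreal (vol CARD('n) r))"
    using S nn_integral_shadow_count_le[of r x0] emeasure_lebesgue_cball[of r x0] r
    by (intro add_mono mult_left_mono) auto
  also have "\<dots> = ennreal (?Cq * 3 ^ CARD('n) * vol CARD('n) r
      + (4 * chain_const * ((8 * (L + 1)) ^ CARD('n) * vol CARD('n) ((L + 3) * r)) + chain_const * (8 * L + 60) * vol CARD('n) r))"
  proof -
    have *: "ennreal a + (ennreal b * ennreal b' + ennreal d * ennreal d') = ennreal (a + (b * b' + d * d'))"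
      if "0 \<le> a" "0 \<le> b" "0 \<le> b'" "0 \<le> d" "0 \<le> d'" for a b b' d d' :: real
      using that by (simp add: ennreal_mult)
    show ?thesis
      by (rule *) (use chain_const_pos L_ge r F_pos in \<open>auto simp: vol_nonneg\<close>)
  qed
  also have "?Cq * 3 ^ CARD('n) * vol CARD('n) r
      + (4 * chain_const * ((8 * (L + 1)) ^ CARD('n) * vol CARD('n) ((L + 3) * r)) + chain_const * (8 * L + 60) * vol CARD('n) r)
    = near_const * F * vol CARD('n) r"
    unfolding vol_mult near_const_def chain_const_def by (simp add: algebra_simps)
  finally show thesis using that i by blast
qed

section \<open>Bounds at a fixed scale\<close>

definition local_const :: real where
  "local_const = 1 + near_const * vol CARD('n) (\<tau> / 10) + 8 ^ CARD('n)"

lemma local_const_nonneg: "0 \<le> local_const"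
  using near_const_nonneg \<tau> by (simp add: local_const_def vol_nonneg)

lemma h_shift:
  assumes "0 \<le> r"
  shows "(\<integral>\<^sup>+y\<in>cball x r. ennreal \<bar>h y - m\<bar> \<partial>lebesgue) \<le> (\<integral>\<^sup>+y\<in>cball x r. ennreal \<bar>h y - m'\<bar> \<partial>lebesgue) + ennreal (\<bar>m' - m\<bar> * vol CARD('n) r)"
proof (rule nn_integral_dist_shift)
  show "set_borel_measurable lebesgue (cball x r) h"
    unfolding set_borel_measurable_def
    by (intro borel_measurable_scaleR borel_measurable_indicator h_measurable) simp
qed (use assms in \<open>simp_all add: emeasure_lebesgue_cball del: emeasure_completion\<close>)

lemma nn_integral_cball_le_const:
  fixes g :: "real ^ 'n \<Rightarrow> real"
  assumes "\<And>y. y \<in> cball x r \<Longrightarrow> \<bar>g y\<bar> \<le> A" "0 \<le> r" "0 \<le> A"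
  shows "(\<integral>\<^sup>+y\<in>cball x r. ennreal \<bar>g y\<bar> \<partial>lebesgue) \<le> ennreal (A * vol CARD('n) r)"
proof -
  have "(\<integral>\<^sup>+y\<in>cball x r. ennreal \<bar>g y\<bar> \<partial>lebesgue) \<le> (\<integral>\<^sup>+y. ennreal A * indicator (cball x r) y \<partial>lebesgue)"
    using assms by (intro nn_integral_mono) (auto split: split_indicator intro!: ennreal_leI)
  also have "\<dots> = ennreal A * emeasure lebesgue (cball x r)"
    by (rule nn_integral_cmult_indicator) simp
  also have "\<dots> = ennreal (A * vol CARD('n) r)"
    using assms by (simp add: emeasure_lebesgue_cball ennreal_mult' del: emeasure_completion)
  finally show ?thesis .
qed

text \<open>The radius \<tau> / 10 is small enough for \<open>near_boundary_le\<close>, and a ball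
  of this radius whose centre is twice as far from \<Omega> falls under \<open>abs_h_far_le\<close>.
  The terms of \<open>local_const\<close> collect the bounds of the three cases;
  \<open>8 ^ CARD('n)\<close> is the ratio of volumes for the radii \<tau> / 10 and \<tau> /
  80.\<close>

lemma h_local_le: "(\<integral>\<^sup>+y\<in>cball x (\<tau> / 10). ennreal \<bar>h y\<bar> \<partial>lebesgue) \<le> ennreal (local_const * F)"
proof -
  define r where "r = \<tau> / 10"
  have r: "0 < r" "3 * r < \<tau>" "r \<le> r0" using \<tau> by (auto simp: r_def)
  have C1v: "0 \<le> near_const * vol CARD('n) r" using near_const_nonneg r by (simp add: vol_nonneg)
  have v8: "F / vol CARD('n) (r / 8) * vol CARD('n) r = 8 ^ CARD('n) * F"
    using vol_mult[of "CARD('n)" 8 "r / 8"] vol_pos[of "r / 8" "CARD('n)"] r by simp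
  consider "cball x r \<subseteq> \<Omega>" | w where "w \<notin> \<Omega>" "dist x w \<le> r" "infdist x \<Omega> < 2 * r" | "2 * r \<le> infdist x \<Omega>"
    by (metis not_le mem_cball subsetI)
  then have "(\<integral>\<^sup>+y\<in>cball x r. ennreal \<bar>h y\<bar> \<partial>lebesgue) \<le> ennreal (local_const * F)"
  proof cases
    case 1
    have "(\<integral>\<^sup>+y\<in>cball x r. ennreal \<bar>h y\<bar> \<partial>lebesgue) \<le> (\<integral>\<^sup>+y\<in>cball x r0 \<inter> \<Omega>. ennreal \<bar>f y\<bar> \<partial>lebesgue)"
      using 1 r by (intro nn_integral_mono) (auto simp: h_inside split: split_indicator)
    also have "\<dots> \<le> ennreal F" by (rule local_le)
    also have "\<dots> \<le> ennreal (local_const * F)"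
      using C1v F_pos by (intro ennreal_leI) (simp add: local_const_def r_def[symmetric])
    finally show ?thesis .
  next
    case 2
    obtain i where i: "r / 2 \<le> l i" "l i \<le> 4 * r"
      "(\<integral>\<^sup>+y\<in>cball x r. ennreal \<bar>h y - mean i\<bar> \<partial>lebesgue) \<le> ennreal (near_const * F * vol CARD('n) r)"
      using near_boundary_le[OF 2 r(1,2)] .
    have "\<bar>mean i\<bar> \<le> F / vol CARD('n) (r / 8)"
      by (rule abs_mean_le) (use i r in auto)
    then have m: "\<bar>mean i\<bar> * vol CARD('n) r \<le> 8 ^ CARD('n) * F"
      unfolding v8[symmetric] using r by (intro mult_right_mono) (auto simp: vol_nonneg)
    have "(\<integral>\<^sup>+y\<in>cball x r. ennreal \<bar>h y - 0\<bar> \<partial>lebesgue)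
      \<le> (\<integral>\<^sup>+y\<in>cball x r. ennreal \<bar>h y - mean i\<bar> \<partial>lebesgue) + ennreal (\<bar>mean i - 0\<bar> * vol CARD('n) r)"
      using r by (intro h_shift) auto
    also have "\<dots> \<le> ennreal (near_const * F * vol CARD('n) r) + ennreal (8 ^ CARD('n) * F)"
      using i m by (intro add_mono ennreal_leI) auto
    also have "\<dots> = ennreal (near_const * F * vol CARD('n) r + 8 ^ CARD('n) * F)"
      using F_pos near_const_nonneg r by (simp add: vol_nonneg flip: ennreal_plus)
    also have "\<dots> \<le> ennreal (local_const * F)"
      using F_pos by (intro ennreal_leI) (simp add: local_const_def algebra_simps r_def[symmetric])
    finally show ?thesis by simp
  next
    case 3
    have "\<bar>h y\<bar> \<le> F / vol CARD('n) (r / 8)" if y: "y \<in> cball x r" for y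
    proof -
      have d: "r \<le> infdist y \<Omega>" using infdist_triangle[of x \<Omega> y] 3 y by simp
      then have "y \<notin> \<Omega>" using r by auto
      then show ?thesis using abs_h_far_le[of y] d by (simp add: r_def)
    qed
    then have "(\<integral>\<^sup>+y\<in>cball x r. ennreal \<bar>h y\<bar> \<partial>lebesgue) \<le> ennreal (F / vol CARD('n) (r / 8) * vol CARD('n) r)"
      using r F_pos by (intro nn_integral_cball_le_const) (auto simp: vol_nonneg)
    also have "\<dots> \<le> ennreal (local_const * F)"
      unfolding v8 using C1v F_pos by (intro ennreal_leI) (simp add: local_const_def r_def[symmetric] distrib_right)
    finally show ?thesis .
  qed
  then show ?thesis by (simp add: r_def)
qed

definition large_const :: real where
  "large_const = 3 ^ CARD('n) * local_const / vol CARD('n) (\<tau> / 10)"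

lemma large_const_nonneg: "0 \<le> large_const"
  using local_const_nonneg \<tau> by (simp add: large_const_def vol_nonneg)

text \<open>On large balls no cancellation is used: the mean of |h| itself is bounded, by covering
  with balls of radius \<tau> / 10.\<close>

lemma h_large_le:
  assumes "\<tau> / 10 \<le> r"
  shows "(\<integral>\<^sup>+y\<in>cball x r. ennreal \<bar>h y\<bar> \<partial>lebesgue) \<le> ennreal (large_const * F * vol CARD('n) r)"
proof -
  have "(\<integral>\<^sup>+y\<in>cball x r. ennreal \<bar>h y\<bar> \<partial>lebesgue) \<le> ennreal (3 ^ CARD('n) * vol CARD('n) r / vol CARD('n) (\<tau> / 10) * (local_const * F))"
    by (rule nn_integral_cball_le_of_small[OF _ h_local_le]) (use assms \<tau> local_const_nonneg F_pos in auto)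
  then show ?thesis by (simp add: large_const_def mult_ac)
qed

lemma h_set_integrable:
  assumes "compact S"
  shows "set_integrable lebesgue S h"
proof -
  obtain r where r: "S \<subseteq> cball 0 r" using bounded_subset_ballD[OF compact_imp_bounded[OF assms], of 0] ball_subset_cball by blast
  have "S \<subseteq> cball 0 (max r (\<tau> / 10))" using r by auto
  then have "(\<integral>\<^sup>+y\<in>S. ennreal \<bar>h y\<bar> \<partial>lebesgue) \<le> (\<integral>\<^sup>+y\<in>cball 0 (max r (\<tau> / 10)). ennreal \<bar>h y\<bar> \<partial>lebesgue)"
    by (rule nn_set_integral_set_mono)
  also have "\<dots> < \<infinity>" using h_large_le[of "max r (\<tau> / 10)" 0] by (auto simp: top_unique less_top[symmetric])
  finally have "(\<integral>\<^sup>+y\<in>S. ennreal \<bar>h y\<bar> \<partial>lebesgue) < \<infinity>" .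
  moreover have "ennreal (norm (indicator S y *\<^sub>R h y)) = ennreal \<bar>h y\<bar> * indicator S y" for y
    by (auto split: split_indicator)
  moreover have "S \<in> sets lebesgue" using lmeasurable_compact[OF assms] by (rule fmeasurableD)
  then have "(\<lambda>y. indicator S y *\<^sub>R h y) \<in> borel_measurable lebesgue"
    by (intro borel_measurable_scaleR borel_measurable_indicator h_measurable)
  ultimately show ?thesis
    unfolding set_integrable_def by (intro integrableI_bounded) simp_all
qed

section \<open>Balls far from the domain\<close>

definition far_const :: real where
  "far_const = 1 / vol CARD('n) (\<tau> / 80) + adjacency_const * K * (6 * L + 46)"

lemma far_const_nonneg: "0 \<le> far_const"
  using adjacency_const_pos K_pos L_ge \<tau> by (simp add: far_const_def vol_nonneg)

text \<open>On such a ball the distance to \<Omega> stays between \<open>d / 2\<close> and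
  \<open>3 / 2 * d\<close>, so all reflected cubes have comparable size and position, and their
  means differ by a bounded amount.\<close>

lemma far_from_domain_le:
  assumes r: "0 < r" "2 * r \<le> infdist x0 \<Omega>"
  obtains m where "(\<integral>\<^sup>+y\<in>cball x0 r. ennreal \<bar>h y - m\<bar> \<partial>lebesgue) \<le> ennreal (far_const * F * vol CARD('n) r)"
proof -
  define d where "d = infdist x0 \<Omega>"
  have d0: "0 < d" using r by (simp add: d_def)
  have dy: "d / 2 \<le> infdist y \<Omega>" "infdist y \<Omega> \<le> 3 / 2 * d" if "y \<in> cball x0 r" for y
    using infdist_triangle[of x0 \<Omega> y] infdist_triangle[of y \<Omega> x0] that r by (auto simp: d_def dist_commute)
  have ny: "y \<notin> \<Omega>" if "y \<in> cball x0 r" for y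
    using dy(1)[OF that] d0 by auto
  have A: "0 \<le> F / vol CARD('n) (\<tau> / 80)" "0 \<le> adjacency_const * F * K * (6 * L + 46)"
    using F_pos adjacency_const_pos K_pos L_ge \<tau> by (auto simp: vol_nonneg)
  have far_bound: "far_const * F = F / vol CARD('n) (\<tau> / 80) + adjacency_const * F * K * (6 * L + 46)"
    by (simp add: far_const_def algebra_simps)
  have "\<exists>m. \<forall>y\<in>cball x0 r. \<bar>h y - m\<bar> \<le> far_const * F"
  \<comment> \<open>For \<open>d < \<tau> / 2\<close> the whole ball stays below distance \<tau>,
    where \<open>h\<close> is given by reflection; otherwise every point is far enough for
    \<open>abs_h_far_le\<close>.\<close>
  proof (cases "d < \<tau> / 2")
    case False
    have "\<bar>h y - 0\<bar> \<le> far_const * F" if "y \<in> cball x0 r" for y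
      using abs_h_far_le[OF ny[OF that]] dy(1)[OF that] False A \<tau> unfolding far_bound by simp
    then show ?thesis by blast
  next
    case True
    have x0: "x0 \<in> cball x0 r" using r by simp
    have "d < \<tau>" using True \<tau> by linarith
    note hx = h_outside[OF ny[OF x0], folded d_def, OF d0 this]
    have "\<bar>h y - h x0\<bar> \<le> far_const * F" if y: "y \<in> cball x0 r" for y
    proof -
      have y0: "0 < infdist y \<Omega>" "infdist y \<Omega> < \<tau>" using dy[OF y] d0 True by linarith+
      note hy = h_outside[OF ny[OF y] this]
      let ?j = "reflection y" and ?i = "reflection x0"
      have "dist y (c ?j) \<le> (L + 5) * (3 / 2 * d)"
        using hy(4) dy(2)[OF y] L_ge by (rule_tac order_trans[OF _ mult_left_mono[of "infdist y \<Omega>" "3 / 2 * d"]]) auto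
      moreover have "dist x0 y \<le> d / 2" using y r by (simp add: d_def)
      moreover have "dist (c ?j) (c ?i) \<le> dist y (c ?j) + dist x0 y + dist x0 (c ?i)"
        using dist_triangle[of "c ?j" "c ?i" y] dist_triangle[of y "c ?i" x0] by (simp add: dist_commute)
      moreover have "0 \<le> L * d" using L_ge d0 by simp
      ultimately have dd: "dist (c ?j) (c ?i) \<le> (3 * L + 15) * d"
        using hx(4) d0 by (simp add: algebra_simps)
      have l1: "d / 4 \<le> l ?j" "l ?j \<le> 12 * d" using hy(2,3) dy[OF y] d0 by linarith+
      have "ln (d / l ?j) \<le> 4 * real 1"
        using l1 d0 by (intro ln_le_four_mult) (auto simp: pos_divide_le_eq)
      then have "log_dist Q ?j ?i \<le> 6 * L + 46"
        using log_dist_le_ln[OF l1(2) hx(2,3) d0 dd] by simp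
      then have "adjacency_const * F * (K * log_dist Q ?j ?i) \<le> adjacency_const * F * (K * (6 * L + 46))"
        using adjacency_const_pos F_pos K_pos by (intro mult_left_mono) auto
      then have "\<bar>mean ?j - mean ?i\<bar> \<le> adjacency_const * F * K * (6 * L + 46)"
        using mean_diff_le[of ?j ?i] by (simp only: mult.assoc)
      then show ?thesis using A unfolding hx(1) hy(1) far_bound by linarith
    qed
    then show ?thesis by blast
  qed
  then obtain m where "\<And>y. y \<in> cball x0 r \<Longrightarrow> \<bar>h y - m\<bar> \<le> far_const * F" by blast
  then have "(\<integral>\<^sup>+y\<in>cball x0 r. ennreal \<bar>h y - m\<bar> \<partial>lebesgue) \<le> ennreal (far_const * F * vol CARD('n) r)"
    using r far_const_nonneg F_pos by (intro nn_integral_cball_le_const) auto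
  then show thesis by (rule that)
qed

section \<open>Oscillation on all balls and the norm\<close>

definition oscillation_const :: real where "oscillation_const = 1 + near_const + large_const + far_const"

text \<open>A ball inside \<Omega> is covered by the norm of \<open>f\<close>, a large one by the
  bound on \<open>h\<close> itself. Any other ball either meets the complement close to \<Omega> or
  is far from \<Omega> relative to its radius.\<close>

lemma oscillation_h_le:
  assumes r: "0 < r"
  shows "(\<integral>\<^sup>+y\<in>cball x r. ennreal \<bar>h y - average (cball x r) h\<bar> \<partial>lebesgue) \<le> ennreal (2 * (oscillation_const * F) * vol CARD('n) r)"
proof -
  have le: "ennreal (a * F * vol CARD('n) r) \<le> ennreal (oscillation_const * F * vol CARD('n) r)" if "a \<le> oscillation_const" for a
    using that F_pos r by (intro ennreal_leI mult_right_mono) (auto simp: vol_nonneg)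
  have osc_const: "1 \<le> oscillation_const" "near_const \<le> oscillation_const" "large_const \<le> oscillation_const" "far_const \<le> oscillation_const"
    using near_const_nonneg large_const_nonneg far_const_nonneg by (auto simp: oscillation_const_def)
  consider "cball x r \<subseteq> \<Omega>" | "\<tau> / 10 \<le> r"
    | w where "r < \<tau> / 10" "w \<notin> \<Omega>" "dist x w \<le> r" "infdist x \<Omega> < 2 * r" | "2 * r \<le> infdist x \<Omega>"
    by (metis not_le mem_cball subsetI)
  then have "\<exists>m. (\<integral>\<^sup>+y\<in>cball x r. ennreal \<bar>h y - m\<bar> \<partial>lebesgue) \<le> ennreal (oscillation_const * F * vol CARD('n) r)"
  proof cases
    case 1
    have "(\<integral>\<^sup>+y\<in>cball x r. ennreal \<bar>h y - average (cball x r) f\<bar> \<partial>lebesgue)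
      = (\<integral>\<^sup>+y\<in>cball x r. ennreal \<bar>f y - average (cball x r) f\<bar> \<partial>lebesgue)"
      using 1 by (intro nn_integral_cong) (auto simp: h_inside split: split_indicator)
    also have "\<dots> \<le> ennreal (1 * F * vol CARD('n) r)" using oscillation_le[OF r 1] by simp
    finally show ?thesis by (blast intro: order_trans[OF _ le[OF osc_const(1)]])
  next
    case 2
    have "(\<integral>\<^sup>+y\<in>cball x r. ennreal \<bar>h y - 0\<bar> \<partial>lebesgue) \<le> ennreal (large_const * F * vol CARD('n) r)"
      using h_large_le[OF 2] by simp
    then show ?thesis by (blast intro: order_trans[OF _ le[OF osc_const(3)]])
  next
    case 3
    have "3 * r < \<tau>" using 3(1) r by linarith
    then obtain i where "(\<integral>\<^sup>+y\<in>cball x r. ennreal \<bar>h y - mean i\<bar> \<partial>lebesgue) \<le> ennreal (near_const * F * vol CARD('n) r)"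
      by (rule near_boundary_le[OF 3(2-4) r])
    from order_trans[OF this le[OF osc_const(2)]] show ?thesis by blast
  next
    case 4
    obtain m where "(\<integral>\<^sup>+y\<in>cball x r. ennreal \<bar>h y - m\<bar> \<partial>lebesgue) \<le> ennreal (far_const * F * vol CARD('n) r)"
      by (rule far_from_domain_le[OF r 4])
    from order_trans[OF this le[OF osc_const(4)]] show ?thesis by blast
  qed
  then obtain m where m: "(\<integral>\<^sup>+y\<in>cball x r. ennreal \<bar>h y - m\<bar> \<partial>lebesgue) \<le> ennreal (oscillation_const * F * vol CARD('n) r)"
    by blast
  show ?thesis
    by (rule nn_integral_dist_average_le[OF h_set_integrable _ _ _ m])
      (use r F_pos osc_const in \<open>auto simp: emeasure_lebesgue_cball vol_pos simp del: emeasure_completion\<close>)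
qed

definition extension_const :: real where "extension_const = 2 * oscillation_const + large_const * vol CARD('n) r0"

lemma extension_const_pos: "0 < extension_const"
  using near_const_nonneg large_const_nonneg far_const_nonneg r0_pos by (simp add: extension_const_def oscillation_const_def vol_nonneg add_pos_nonneg)

text \<open>All balls of the space have been estimated, so \<open>D\<close> can be
  arbitrary.\<close>

lemma bmo_norm_h_le: "bmo_norm r0 D h \<le> ennreal (extension_const * F)"
proof -
  have osc_const: "0 \<le> oscillation_const" using near_const_nonneg large_const_nonneg far_const_nonneg by (simp add: oscillation_const_def)
  have "(SUP (x, r) \<in> {(x, r). 0 < r \<and> cball x r \<subseteq> D}.
      (\<integral>\<^sup>+ y \<in> cball x r. ennreal \<bar>h y - average (cball x r) h\<bar> \<partial>lebesgue) / emeasure lebesgue (cball x r))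
    \<le> ennreal (2 * oscillation_const * F)"
  proof (intro SUP_least, clarify)
    fix x :: "real ^ 'n" and r :: real assume r: "0 < r"
    show "(\<integral>\<^sup>+ y \<in> cball x r. ennreal \<bar>h y - average (cball x r) h\<bar> \<partial>lebesgue) / emeasure lebesgue (cball x r)
      \<le> ennreal (2 * oscillation_const * F)"
    proof (rule divide_le_posI_ennreal)
      show "0 < emeasure lebesgue (cball x r)"
        using r by (simp add: emeasure_lebesgue_cball vol_pos del: emeasure_completion)
      show "(\<integral>\<^sup>+ y \<in> cball x r. ennreal \<bar>h y - average (cball x r) h\<bar> \<partial>lebesgue)
        \<le> emeasure lebesgue (cball x r) * ennreal (2 * oscillation_const * F)"
      proof -
        have "emeasure lebesgue (cball x r) * ennreal (2 * oscillation_const * F) = ennreal (vol CARD('n) r * (2 * oscillation_const * F))"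
          using r osc_const F_pos by (subst emeasure_lebesgue_cball) (auto simp: ennreal_mult vol_nonneg)
        also have "vol CARD('n) r * (2 * oscillation_const * F) = 2 * (oscillation_const * F) * vol CARD('n) r" by simp
        finally show ?thesis using oscillation_h_le[OF r, of x] by simp
      qed
    qed
  qed
  moreover have "(SUP x. \<integral>\<^sup>+ y \<in> cball x r0 \<inter> D. ennreal \<bar>h y\<bar> \<partial>lebesgue) \<le> ennreal (large_const * vol CARD('n) r0 * F)"
  proof (intro SUP_least)
    fix x :: "real ^ 'n"
    have "(\<integral>\<^sup>+ y \<in> cball x r0 \<inter> D. ennreal \<bar>h y\<bar> \<partial>lebesgue) \<le> (\<integral>\<^sup>+ y \<in> cball x r0. ennreal \<bar>h y\<bar> \<partial>lebesgue)"
      by (intro nn_set_integral_set_mono) auto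
    also have "\<dots> \<le> ennreal (large_const * F * vol CARD('n) r0)" using \<tau> by (intro h_large_le) auto
    finally show "(\<integral>\<^sup>+ y \<in> cball x r0 \<inter> D. ennreal \<bar>h y\<bar> \<partial>lebesgue) \<le> ennreal (large_const * vol CARD('n) r0 * F)"
      by (simp add: mult_ac)
  qed
  ultimately have "bmo_norm r0 D h \<le> ennreal (2 * oscillation_const * F) + ennreal (large_const * vol CARD('n) r0 * F)"
    unfolding bmo_norm_def by (rule add_mono)
  also have "\<dots> = ennreal (extension_const * F)"
    using osc_const large_const_nonneg F_pos r0_pos by (simp add: extension_const_def distrib_right vol_nonneg flip: ennreal_plus)
  finally show ?thesis .
qed

end

section \<open>Linearity, boundedness and support\<close>

lemma average_cong_ae:
  assumes "ae_eq_on D f g" "A \<subseteq> D" "set_integrable lebesgue A f" "set_integrable lebesgue A g"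
  shows "average A f = average A g"
proof -
  have "AE x in lebesgue. indicator A x *\<^sub>R f x = indicator A x *\<^sub>R g x"
    using assms(1) unfolding ae_eq_on_def by eventually_elim (use assms(2) in \<open>auto split: split_indicator\<close>)
  then have "(LINT x:A|lebesgue. f x) = (LINT x:A|lebesgue. g x)"
    unfolding set_lebesgue_integral_def using assms(3,4)
    by (intro integral_cong_AE) (auto simp: set_integrable_def)
  then show ?thesis by (simp add: average_def)
qed

lemma average_linear:
  assumes "set_integrable lebesgue A f" "set_integrable lebesgue A g"
  shows "average A (\<lambda>x. a * f x + b * g x) = a * average A f + b * average A g"
proof -
  have "set_integrable lebesgue A (\<lambda>x. a * f x)" "set_integrable lebesgue A (\<lambda>x. b * g x)"
    using assms by auto
  then have "(LINT x:A|lebesgue. a * f x + b * g x) = a * (LINT x:A|lebesgue. f x) + b * (LINT x:A|lebesgue. g x)"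
    by (simp add: set_integral_add)
  then show ?thesis by (simp add: average_def add_divide_distrib)
qed

context porous_whitney
begin

lemma core_integrable: "f \<in> bmo r0 \<Omega> \<Longrightarrow> set_integrable lebesgue (core j) f"
  using core_subset by (auto simp: bmo_def locally_integrable_def)

lemma extension_cong_ae:
  assumes f: "f \<in> bmo r0 \<Omega>" and g: "g \<in> bmo r0 \<Omega>" and eq: "ae_eq_on \<Omega> f g"
  shows "ae_eq_on D (extension \<tau> f) (extension \<tau> g)"
proof -
  have *: "average (core i) f = average (core i) g" for i
    by (rule average_cong_ae[OF eq core_subset(2)]) (use f g core_integrable in auto)
  from eq show ?thesis
    unfolding ae_eq_on_def extension_def by eventually_elim (auto simp: *)
qed

text \<open>The index \<open>reflection x\<close> does not depend on the function, so linearity is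
  that of averages and holds pointwise.\<close>

lemma extension_linear:
  assumes "f \<in> bmo r0 \<Omega>" "g \<in> bmo r0 \<Omega>"
  shows "extension \<tau> (\<lambda>x. a * f x + b * g x) = (\<lambda>x. a * extension \<tau> f x + b * extension \<tau> g x)"
  using average_linear[OF core_integrable[OF assms(1)] core_integrable[OF assms(2)]]
  by (simp add: extension_def fun_eq_iff)

lemma bmo_extensionI:
  assumes f: "f \<in> bmo r0 \<Omega>" and F: "bmo_norm r0 \<Omega> f \<le> ennreal F" "0 < F" and r0: "0 < r0"
    and \<tau>: "0 < \<tau>" "\<tau> \<le> t0" "\<tau> \<le> r0"
  shows "bmo_extension \<Omega> Q K N t0 f F r0 \<tau>"
proof
  show "set_integrable lebesgue S f" if "compact S" "S \<subseteq> \<Omega>" for S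
    using f that by (simp add: bmo_def locally_integrable_def)
  let ?osc = "SUP (x, r) \<in> {(x, r). 0 < r \<and> cball x r \<subseteq> \<Omega>}.
    (\<integral>\<^sup>+ y \<in> cball x r. ennreal \<bar>f y - average (cball x r) f\<bar> \<partial>lebesgue) / emeasure lebesgue (cball x r)"
  let ?loc = "SUP x. \<integral>\<^sup>+ y \<in> cball x r0 \<inter> \<Omega>. ennreal \<bar>f y\<bar> \<partial>lebesgue"
  have le: "?osc \<le> ennreal F" "?loc \<le> ennreal F"
    using F(1) unfolding bmo_norm_def by (meson add_increasing add_increasing2 order_refl order_trans zero_le)+
  show "(\<integral>\<^sup>+ y \<in> cball x r0 \<inter> \<Omega>. ennreal \<bar>f y\<bar> \<partial>lebesgue) \<le> ennreal F" for x
    using le(2) by (rule order_trans[OF SUP_upper, rotated]) simp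
  show "(\<integral>\<^sup>+ y \<in> cball x r. ennreal \<bar>f y - average (cball x r) f\<bar> \<partial>lebesgue) \<le> ennreal (F * vol CARD('n) r)"
    if r: "0 < r" "cball x r \<subseteq> \<Omega>" for x r
  proof -
    let ?I = "\<integral>\<^sup>+ y \<in> cball x r. ennreal \<bar>f y - average (cball x r) f\<bar> \<partial>lebesgue"
    have v: "emeasure lebesgue (cball x r) = ennreal (vol CARD('n) r)" "0 < vol CARD('n) r"
      using r by (intro emeasure_lebesgue_cball vol_pos; simp)+
    have "?I / emeasure lebesgue (cball x r) \<le> ?osc"
      using r by (intro SUP_upper2[of "(x, r)"]) auto
    then have *: "?I / ennreal (vol CARD('n) r) \<le> ennreal F" using le(1) v(1) by simp
    have "?I = ?I / ennreal (vol CARD('n) r) * ennreal (vol CARD('n) r)"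
      using v(2) by (simp add: ennreal_divide_times ennreal_mult_divide_eq mult_divide_eq_ennreal)
    also have "\<dots> \<le> ennreal F * ennreal (vol CARD('n) r)" using * by (rule mult_right_mono) simp
    also have "\<dots> = ennreal (F * vol CARD('n) r)" using F(2) by (simp add: ennreal_mult')
    finally show ?thesis .
  qed
qed (use assms in auto)

text \<open>Outside its locale the constant has only the dimension, \<open>K\<close>,
  \<open>N\<close>, \<open>r0\<close> and \<tau> as arguments, so one value serves all domains and
  all functions.\<close>

lemma extension_bmo_bound:
  assumes f: "f \<in> bmo r0 \<Omega>" and r0: "0 < r0" and \<tau>: "0 < \<tau>" "\<tau> \<le> t0" "\<tau> \<le> r0"
  defines "C \<equiv> bmo_extension.extension_const TYPE('n) K N r0 \<tau>"
  shows "0 < C" "bmo_norm r0 D (extension \<tau> f) \<le> ennreal C * bmo_norm r0 \<Omega> f"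
    "extension \<tau> f \<in> bmo r0 D"
proof -
  obtain b where b: "bmo_norm r0 \<Omega> f = ennreal b" "0 \<le> b"
    using f by (auto simp: bmo_def less_top_ennreal)
  have ext: "bmo_extension \<Omega> Q K N t0 f (b + e) r0 \<tau>" if "0 < e" for e
    using that b by (intro bmo_extensionI[OF f _ _ r0 \<tau>]) (auto intro: ennreal_leI)
  show C: "0 < C" unfolding C_def by (rule bmo_extension.extension_const_pos[OF ext[of 1]]) simp
  show bound: "bmo_norm r0 D (extension \<tau> f) \<le> ennreal C * bmo_norm r0 \<Omega> f"
  proof (rule ennreal_le_epsilon)
    fix e :: real assume e: "0 < e"
    \<comment> \<open>The bound \<open>F\<close> must be positive even when the norm is zero; the
      excess \<open>e / C\<close> over the norm costs only \<open>e\<close> in the end.\<close>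
    have "bmo_norm r0 D (extension \<tau> f) \<le> ennreal (C * (b + e / C))"
      unfolding C_def by (rule bmo_extension.bmo_norm_h_le[OF ext]) (use e C in \<open>simp add: C_def\<close>)
    also have "\<dots> = ennreal C * bmo_norm r0 \<Omega> f + ennreal e"
      using C b e by (simp add: distrib_left ennreal_mult')
    finally show "bmo_norm r0 D (extension \<tau> f) \<le> ennreal C * bmo_norm r0 \<Omega> f + ennreal e" .
  qed
  have "locally_integrable D (extension \<tau> f)"
    unfolding locally_integrable_def using bmo_extension.h_set_integrable[OF ext[of 1]] by simp
  moreover have "bmo_norm r0 D (extension \<tau> f) < \<infinity>"
    using bound b by (simp add: le_less_trans ennreal_mult_less_top)
  ultimately show "extension \<tau> f \<in> bmo r0 D" by (simp add: bmo_def)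
qed

lemma ess_support_extension:
  assumes "\<tau> \<le> \<epsilon>" "0 < \<epsilon>"
  shows "ess_support D (extension \<tau> f) \<subseteq> closure (neighbourhood \<Omega> \<epsilon>)"
proof
  fix x assume x: "x \<in> ess_support D (extension \<tau> f)"
  show "x \<in> closure (neighbourhood \<Omega> \<epsilon>)"
  proof (rule ccontr)
    let ?U = "- closure (neighbourhood \<Omega> \<epsilon>)"
    assume "x \<notin> closure (neighbourhood \<Omega> \<epsilon>)"
    have "extension \<tau> f y = 0" if "y \<in> ?U" for y
    proof -
      have "y \<notin> neighbourhood \<Omega> \<epsilon>" using that closure_subset by blast
      then have "\<epsilon> \<le> infdist y (closure \<Omega>)" by (simp add: neighbourhood_def)
      moreover have "\<Omega> \<noteq> {}" using Union_q centre_in_cube by blast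
      then have "infdist y (closure \<Omega>) \<le> infdist y \<Omega>" using closure_subset by (intro infdist_mono)
      ultimately have d: "\<epsilon> \<le> infdist y \<Omega>" by simp
      then have "y \<notin> \<Omega>" using assms(2) by auto
      then show ?thesis using d assms(1) by (simp add: extension_def)
    qed
    then have "ae_eq_on (?U \<inter> D) (extension \<tau> f) (\<lambda>_. 0)" by (simp add: ae_eq_on_def)
    moreover have "open ?U" by auto
    ultimately show False
      using x \<open>x \<notin> closure (neighbourhood \<Omega> \<epsilon>)\<close> unfolding ess_support_def by blast
  qed
qed

end

text \<open>The radius \<rho> of an inscribed ball is fixed in advance because the constant must
  depend on it. On a ball of small radius \<eta> the function 1 has norm of order \<eta>^n, while
  any extension has norm at least of order 1 / log (1 / \<eta>); yet dyadic scaling leaves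
  \<open>K\<close> unchanged.\<close>

theorem theorem12:
  fixes r0 K \<epsilon> \<rho> :: real
  assumes "0 < r0" and "0 < K" and "0 < \<epsilon>" and "0 < \<rho>"
  shows "\<exists>C>0. \<forall>\<Omega> :: (real ^ 'n::finite) set.
    uniform_domain \<Omega> \<and> has_uniformity_constant \<Omega> K \<and> (\<exists>x. cball x \<rho> \<subseteq> \<Omega>) \<longrightarrow>
    (\<exists>E. linear_extension_operator r0 \<Omega> (neighbourhood \<Omega> (2 * \<epsilon>)) E \<and>
      (\<forall>f \<in> bmo r0 \<Omega>.
         bmo_norm r0 (neighbourhood \<Omega> (2 * \<epsilon>)) (E f) \<le> ennreal C * bmo_norm r0 \<Omega> f \<and>
         ess_support (neighbourhood \<Omega> (2 * \<epsilon>)) (E f) \<subseteq> closure (neighbourhood \<Omega> \<epsilon>)))"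
proof -
  define s where "s = sqrt (real CARD('n))"
  have s: "1 \<le> s" unfolding s_def by (rule one_le_sqrt_card)
  \<comment> \<open>The bound supplied by \<open>linear_le_log_bound\<close>.\<close>
  define N where "N = 2 * (K * ln 8 + K * ln (8 * s * K) + (2 + 4 * s) / (8 * s))"
  \<comment> \<open>By \<open>side_ge_of_cball_subset\<close>, a ball of radius \<rho> in \<Omega>
    forces a cube of at least this side.\<close>
  define t0 where "t0 = \<rho> / (5 * s)"
  define \<tau> where "\<tau> = min \<epsilon> (min t0 r0)"
  have \<tau>: "0 < \<tau>" "\<tau> \<le> t0" "\<tau> \<le> r0" "\<tau> \<le> \<epsilon>"
    using assms s by (auto simp: \<tau>_def t0_def)
  define C where "C = bmo_extension.extension_const TYPE('n) K N r0 \<tau>"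
  show ?thesis
  \<comment> \<open>The constant is chosen before the domain, whereas the positivity of
    \<open>C\<close> is derived from a domain at hand; \<open>max 1 C\<close> is positive
    outright.\<close>
  proof (intro exI[of _ "max 1 C"] conjI allI impI)
    fix \<Omega> :: "(real ^ 'n) set"
    assume \<Omega>: "uniform_domain \<Omega> \<and> has_uniformity_constant \<Omega> K \<and> (\<exists>x. cball x \<rho> \<subseteq> \<Omega>)"
    then obtain Q where Q: "whitney_decomposition \<Omega> Q" "\<And>j k. chain_dist Q j k \<le> ereal (K * log_dist Q j k)"
      unfolding has_uniformity_constant_def by blast
    obtain x where x: "cball x \<rho> \<subseteq> \<Omega>" using \<Omega> by blast
    have W: "whitney \<Omega> Q" using Q(1) by unfold_locales
    have "x \<in> \<Omega>" using x assms by auto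
    then obtain k where k: "x \<in> cube (Q k)" using whitney.Union_q[OF W] by blast
    have "\<rho> \<le> 5 * s * side (Q k)"
      using whitney.side_ge_of_cball_subset[OF W k x] by (simp add: s_def)
    then have "t0 \<le> side (Q k)" using s by (simp add: t0_def pos_divide_le_eq mult_ac)
    then have "porous_whitney \<Omega> Q K N t0"
      using Q assms(2) s linear_le_log_bound[of K s]
      by unfold_locales (auto simp: N_def s_def)
    then interpret porous_whitney \<Omega> Q s K N "8 * (N + 1) * s" t0
      by (simp_all add: s_def)
    let ?D = "neighbourhood \<Omega> (2 * \<epsilon>)"
    note bound = extension_bmo_bound[OF _ assms(1) \<tau>(1-3), folded C_def]
    have "linear_extension_operator r0 \<Omega> ?D (extension \<tau>)"
      unfolding linear_extension_operator_def
    proof (intro conjI ballI allI impI)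
      fix f g assume fg: "f \<in> bmo r0 \<Omega>" "g \<in> bmo r0 \<Omega>"
      show "ae_eq_on ?D (extension \<tau> f) (extension \<tau> g)" if "ae_eq_on \<Omega> f g"
        using extension_cong_ae[OF fg that] .
      show "ae_eq_on ?D (extension \<tau> (\<lambda>x. a * f x + b * g x)) (\<lambda>x. a * extension \<tau> f x + b * extension \<tau> g x)" for a b
        by (simp add: extension_linear[OF fg] ae_eq_on_def)
    next
      fix f assume f: "f \<in> bmo r0 \<Omega>"
      show "extension \<tau> f \<in> bmo r0 ?D" using bound(3)[OF f] .
      show "ae_eq_on \<Omega> (extension \<tau> f) f" by (simp add: ae_eq_on_def extension_def)
    qed
    moreover have "bmo_norm r0 ?D (extension \<tau> f) \<le> ennreal (max 1 C) * bmo_norm r0 \<Omega> f" if f: "f \<in> bmo r0 \<Omega>" for f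
    proof -
      have "ennreal C * bmo_norm r0 \<Omega> f \<le> ennreal (max 1 C) * bmo_norm r0 \<Omega> f"
        by (intro mult_right_mono ennreal_leI) auto
      then show ?thesis using bound(2)[OF f, of ?D] order_trans by blast
    qed
    ultimately show "\<exists>E. linear_extension_operator r0 \<Omega> ?D E \<and>
      (\<forall>f \<in> bmo r0 \<Omega>. bmo_norm r0 ?D (E f) \<le> ennreal (max 1 C) * bmo_norm r0 \<Omega> f \<and>
         ess_support ?D (E f) \<subseteq> closure (neighbourhood \<Omega> \<epsilon>))"
      using ess_support_extension[OF \<tau>(4) assms(3)] by blast
  qed simp
qed

end
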